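(* Let $$\mathcal{Z}_{(0)} = \sum_{\mu} e^{-|\mu|t}\, W_{\mu^t}(q, e^{-t})\,(-1)^{|\mu|} Q^{|\mu|}\, W_{\mu}(q, e^{-t}),$$ the sum being over all partitions $\mu$ (this is the deformed partition function of the resolved conifold). Then, as formal power series in $Q$, $$\mathcal{Z}_{(0)} = \exp\left(-\sum_{n=1}^{\infty} \frac{Q^n}{n}\,\frac{(1 - e^{-nt})^2}{(q^{n/2} - q^{-n/2})^2}\right) = \prod_{n=1}^{\infty} \frac{(1 - Qq^n)^n\,(1 - Qe^{-2t}q^n)^n}{(1 - Qe^{-t}q^n)^{2n}}.$$
   Context: Partitions: $\mu=(\mu_1\ge\cdots\ge\mu_l>0)$, $|\mu|=\sum_i\mu_i$, $\mu^t$ the transposed partition. For a box $x=(i,j)$ of the Young diagram ($1\le i\le l$, $1\le j\le \mu_i$), $c(x)=j-i$ and $h(x)=\mu_i+\mu^t_j-i-j+1$. The quantum dimension is $W_\mu(q,e^{-t})=\prod_{x\in\mu}\dfrac{e^{t/2}q^{c(x)/2}-e^{-t/2}q^{-c(x)/2}}{q^{h(x)/2}-q^{-h(x)/2}}$, with value $1$ for the empty partition. The infinite product is understood by expanding rational functions of $q$ in the region $|q|<1$. *)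

theory Defs
  imports "HOL-Analysis.Analysis" "HOL-Computational_Algebra.Formal_Power_Series"
begin

text \<open>
  A partition is the list of its parts in weakly decreasing order. Rows and columns of Young
  diagrams are numbered from 1.
\<close>

definition is_partition :: "nat list \<Rightarrow> bool" where
  "is_partition \<mu> \<longleftrightarrow> sorted_wrt (\<ge>) \<mu> \<and> (\<forall>m\<in>set \<mu>. m > 0)"

definition part :: "nat list \<Rightarrow> nat \<Rightarrow> nat" where
  "part \<mu> i = (if 1 \<le> i \<and> i \<le> length \<mu> then \<mu> ! (i - 1) else 0)"

definition transposed :: "nat list \<Rightarrow> nat list" where
  "transposed \<mu> = map (\<lambda>j. length (filter (\<lambda>m. j \<le> m) \<mu>)) [1..<Suc (part \<mu> 1)]"

definition boxes :: "nat list \<Rightarrow> (nat \<times> nat) set" where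
  "boxes \<mu> = {(i, j). 1 \<le> i \<and> i \<le> length \<mu> \<and> 1 \<le> j \<and> j \<le> part \<mu> i}"

definition content :: "nat \<times> nat \<Rightarrow> int" where
  "content x = (case x of (i, j) \<Rightarrow> int j - int i)"

definition hook :: "nat list \<Rightarrow> nat \<times> nat \<Rightarrow> int" where
  "hook \<mu> x = (case x of (i, j) \<Rightarrow>
     int (part \<mu> i) + int (part (transposed \<mu>) j) - int i - int j + 1)"

text \<open>
  The quantum dimension \<open>W\<^sub>\<mu>(q, e\<^sup>-\<^sup>t)\<close>. The argument \<open>s\<close> is a square root of \<open>q\<close>,
  so that \<open>s powi k\<close> is the half-integer power of \<open>q\<close> with exponent \<open>k / 2\<close>.
\<close>

definition quantum_dim :: "complex \<Rightarrow> complex \<Rightarrow> nat list \<Rightarrow> complex" where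
  "quantum_dim s t \<mu> =
     (\<Prod>x\<in>boxes \<mu>.
        (exp (t / 2) * s powi content x - exp (- t / 2) * s powi (- content x)) /
        (s powi hook \<mu> x - s powi (- hook \<mu> x)))"

text \<open>
  The formal variable \<open>Q\<close> is \<open>fps_X\<close>. The sum over all partitions is taken in the \<open>Q\<close>-adic
  topology, which is the library's topology on \<open>fps\<close>.
\<close>

definition conifold_Z :: "complex \<Rightarrow> complex \<Rightarrow> complex fps" where
  "conifold_Z s t =
     (\<Sum>\<^sub>\<infinity>\<mu>\<in>{\<mu>. is_partition \<mu>}.
        fps_const (exp (- of_nat (sum_list \<mu>) * t) * quantum_dim s t (transposed \<mu>)
                     * (- 1) ^ sum_list \<mu>)
        * fps_X ^ sum_list \<mu> * fps_const (quantum_dim s t \<mu>))"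

definition conifold_exponent :: "complex \<Rightarrow> complex \<Rightarrow> complex fps" where
  "conifold_exponent s t =
     - Abs_fps (\<lambda>n. if n = 0 then 0 else
         1 / of_nat n * ((1 - exp (- of_nat n * t))\<^sup>2 / (s powi int n - s powi (- int n))\<^sup>2))"

definition conifold_factor :: "complex \<Rightarrow> complex \<Rightarrow> nat \<Rightarrow> complex fps" where
  "conifold_factor q t n =
     (1 - fps_X * fps_const (q ^ n)) ^ n * (1 - fps_X * fps_const (exp (- 2 * t) * q ^ n)) ^ n
     / (1 - fps_X * fps_const (exp (- t) * q ^ n)) ^ (2 * n)"

text \<open>
  The infinite product over \<open>n \<ge> 1\<close>: every coefficient of the partial products converges in the
  complex numbers. The \<open>Q\<close>-adic topology cannot be used here, because every factor changes the
  coefficient of \<open>Q\<close>.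
\<close>

definition has_coeffwise_prod :: "(nat \<Rightarrow> complex fps) \<Rightarrow> complex fps \<Rightarrow> bool" where
  "has_coeffwise_prod f P \<longleftrightarrow>
     (\<forall>k. (\<lambda>N. fps_nth (\<Prod>n = 1..N. f n) k) \<longlonglongrightarrow> fps_nth P k)"

end

theory Submission
  imports Defs "Jordan_Normal_Form.Determinant"
begin

text \<open>
  Write \<open>a = e\<^sup>-\<^sup>t\<close>. Since transposition negates contents and preserves hook lengths, the term of \<open>\<mu>\<close>
  is \<open>(-Q)\<^bsup>|\<mu>|\<^esup>\<close> times the product over the boxes of \<open>(1 - a q\<^sup>c) (1 - a q\<^sup>-\<^sup>c) q\<^sup>h / (1 - q\<^sup>h)\<^sup>2\<close>. Both
  sides have coefficients polynomial in \<open>a\<close>, so it suffices to treat \<open>a = q\<^sup>n\<close>, where only partitions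
  inside an \<open>n \<times> n\<close> square contribute and the exponential is the product of the \<open>1 - Q q\<^bsup>i+j+1\<^esup>\<close>
  over \<open>i, j < n\<close>.

  For \<open>l\<^sub>i = \<mu>\<^sub>i\<^sub>+\<^sub>1 + n - 1 - i\<close>, the hook formula turns the term into the square of the Vandermonde
  product of the \<open>q\<close>-powers \<open>X\<^sub>i\<close> with exponents \<open>l\<^sub>i\<close>, times a product of weights \<open>w\<^sub>b(l\<^sub>i)\<close> with
  \<open>b = q\<^sup>n\<close>. As a function of \<open>b\<close> the sum is computed by the step from \<open>b\<close> to \<open>b q\<close>, as in the
  proof of the dual Cauchy identity: one Vandermonde factor obeys a Pieri rule, the other together
  with the weights obeys the adjoint branching rule, and each step produces the factors
  \<open>1 - Q b q\<^bsup>j+1\<^esup>\<close> for \<open>j < n\<close>. At \<open>b = 1\<close> only the empty partition survives.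
\<close>

section \<open>Determinants and Vandermonde products\<close>

definition altsum :: "nat \<Rightarrow> (nat \<Rightarrow> nat \<Rightarrow> 'a :: comm_ring_1) \<Rightarrow> 'a" where
  "altsum n F = Determinant.det (mat n n (\<lambda>(i, j). F i j))"

definition vdm :: "nat \<Rightarrow> (nat \<Rightarrow> 'a :: comm_ring_1) \<Rightarrow> 'a" where
  "vdm n X = (\<Prod>j<n. \<Prod>i<j. X j - X i)"

lemma altsum_leibniz:
  "altsum n F = (\<Sum>p | p permutes {..<n}. signof p * (\<Prod>i<n. F i (p i)))"
proof -
  have "p permutes {..<n} \<Longrightarrow> i < n \<Longrightarrow> p i < n" for p i
    using permutes_in_image[of p "{..<n}" i] by simp
  then show ?thesis
    unfolding altsum_def
    by (subst det_def'[of _ n]) (auto simp: atLeast0LessThan intro!: sum.cong)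
qed

lemma altsum_cong:
  "(\<And>i j. i < n \<Longrightarrow> j < n \<Longrightarrow> F i j = G i j) \<Longrightarrow> altsum n F = altsum n G"
  unfolding altsum_def by (rule arg_cong[where f = Determinant.det]) (auto intro!: eq_matI)

lemma altsum_scale_rows:
  "altsum n (\<lambda>i j. c i * F i j) = (\<Prod>i<n. c i) * altsum n F"
  by (simp add: altsum_leibniz prod.distrib sum_distrib_left mult_ac)

text \<open>Multilinearity of the determinant in its rows: expanding the product over
  \<open>i\<close> for each permutation, \<open>A\<close> collects the rows taken from
  \<open>F\<close>.\<close>

lemma altsum_add:
  "altsum n (\<lambda>i j. F i j + G i j) =
     (\<Sum>A\<in>Pow {..<n}. altsum n (\<lambda>i j. if i \<in> A then F i j else G i j))"
proof -
  have *: "(\<Prod>i<n. if i \<in> A then F i (p i) else G i (p i)) =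
          (\<Prod>i\<in>A. F i (p i)) * (\<Prod>i\<in>{..<n} - A. G i (p i))"
    if "A \<in> Pow {..<n}" for A p
    using that by (subst prod.If_cases) (auto simp: Int_absorb1 Diff_eq)
  show ?thesis
    unfolding altsum_leibniz
    by (subst sum.swap) (auto simp: prod_add sum_distrib_left * intro!: sum.cong)
qed

lemma altsum_triangular:
  assumes "\<And>i j. i < j \<Longrightarrow> j < n \<Longrightarrow> F i j = 0"
  shows "altsum n F = (\<Prod>i<n. F i i)"
  unfolding altsum_def
  by (subst det_lower_triangular[of n]) (use assms in \<open>auto simp: prod_list_diag_prod atLeast0LessThan\<close>)

lemma altsum_transpose: "altsum n (\<lambda>i j. F j i) = altsum n F"
proof -
  have "mat n n (\<lambda>(i, j). F j i) = transpose_mat (mat n n (\<lambda>(i, j). F i j))"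
    by (auto intro!: eq_matI)
  then show ?thesis
    unfolding altsum_def by (simp add: Determinant.det_transpose[of _ n])
qed

lemma altsum_mult:
  "altsum n (\<lambda>i j. \<Sum>k<n. F i k * G k j) = altsum n F * altsum n G"
proof -
  have "mat n n (\<lambda>(i, j). \<Sum>k<n. F i k * G k j)
          = mat n n (\<lambda>(i, j). F i j) * mat n n (\<lambda>(i, j). G i j)"
    by (auto intro!: eq_matI simp: scalar_prod_def atLeast0LessThan)
  then show ?thesis
    unfolding altsum_def by (simp add: Determinant.det_mult[of _ n])
qed

text \<open>The matrix is the Vandermonde matrix times the matrix of coefficients of the
  \<open>P j\<close>, and the degree bound makes the latter triangular.\<close>

lemma altsum_poly_powers:
  assumes "\<And>j. j < n \<Longrightarrow> degree (P j) \<le> j"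
  shows "altsum n (\<lambda>i j. poly (P j) (X i)) = altsum n (\<lambda>i j. X i ^ j) * (\<Prod>j<n. poly.coeff (P j) j)"
proof -
  have "altsum n (\<lambda>i j. poly (P j) (X i)) = altsum n (\<lambda>i j. \<Sum>k<n. X i ^ k * poly.coeff (P j) k)"
  proof (rule altsum_cong)
    fix i j assume "j < n"
    then have "{..j} \<subseteq> {..<n}" by auto
    with \<open>j < n\<close> assms[of j] show "poly (P j) (X i) = (\<Sum>k<n. X i ^ k * poly.coeff (P j) k)"
      by (subst poly_altdef, intro sum.mono_neutral_cong_left)
         (auto simp: coeff_eq_0 mult.commute)
  qed
  also have "\<dots> = altsum n (\<lambda>i j. X i ^ j) * altsum n (\<lambda>k j. poly.coeff (P j) k)"
    by (rule altsum_mult)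
  also have "altsum n (\<lambda>k j. poly.coeff (P j) k) = altsum n (\<lambda>j k. poly.coeff (P j) k)"
    by (rule altsum_transpose)
  also have "\<dots> = (\<Prod>j<n. poly.coeff (P j) j)"
    by (rule altsum_triangular) (metis assms coeff_eq_0 le_less_trans less_trans)
  finally show ?thesis .
qed

text \<open>Replacing the powers by the Newton basis keeps the determinant, since each
  \<open>P j\<close> is monic of degree \<open>j\<close>. As \<open>P j\<close> vanishes at
  \<open>X i\<close> for \<open>i < j\<close>, the new matrix is triangular and its diagonal gives
  the factors of \<open>vdm\<close>.\<close>

lemma altsum_powers: "altsum n (\<lambda>i j. X i ^ j) = vdm n (X :: nat \<Rightarrow> 'a :: idom)"
proof -
  define P where "P j = (\<Prod>k<j. [:- X k, 1:])" for j
  have deg: "degree (P j) = j" for j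
    unfolding P_def by (subst degree_prod_eq_sum_degree) auto
  have "poly.coeff (P j) j = 1" for j
  proof -
    have "lead_coeff (P j) = 1"
      unfolding P_def by (simp add: lead_coeff_prod)
    then show ?thesis by (simp add: deg)
  qed
  then have "altsum n (\<lambda>i j. X i ^ j) = altsum n (\<lambda>i j. poly (P j) (X i))"
    using deg by (subst altsum_poly_powers) auto
  also have "\<dots> = (\<Prod>i<n. poly (P i) (X i))"
    by (rule altsum_triangular) (auto simp: P_def poly_prod intro!: prod_zero)
  also have "\<dots> = vdm n X"
    by (simp add: vdm_def P_def poly_prod)
  finally show ?thesis .
qed

text \<open>Common source of the Pieri and branching rules. Each summand is a determinant with rows
  chosen according to \<open>A\<close>, so by multilinearity the sum is one determinant with
  two-term rows. The hypothesis makes its columns polynomials in \<open>X i\<close> of degree at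
  most \<open>j\<close>, which leads back to the Vandermonde product of \<open>X\<close>.\<close>

lemma vdm_two_term_expansion:
  fixes X Y u v c :: "nat \<Rightarrow> 'a :: idom"
  assumes eq: "\<And>i j. i < n \<Longrightarrow> j < n \<Longrightarrow> u i * Y i ^ j + v i * X i ^ j = c i * poly (P j) (X i)"
    and deg: "\<And>j. j < n \<Longrightarrow> degree (P j) \<le> j"
  shows "(\<Sum>A\<in>Pow {..<n}. (\<Prod>i\<in>A. u i) * (\<Prod>i\<in>{..<n} - A. v i) *
            vdm n (\<lambda>i. if i \<in> A then Y i else X i))
         = (\<Prod>i<n. c i) * (\<Prod>j<n. poly.coeff (P j) j) * vdm n X"
proof -
  have "(\<Prod>i\<in>A. u i) * (\<Prod>i\<in>{..<n} - A. v i) * vdm n (\<lambda>i. if i \<in> A then Y i else X i)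
        = altsum n (\<lambda>i j. if i \<in> A then u i * Y i ^ j else v i * X i ^ j)"
    if "A \<in> Pow {..<n}" for A
  proof -
    have "(\<Prod>i\<in>A. u i) * (\<Prod>i\<in>{..<n} - A. v i) = (\<Prod>i<n. if i \<in> A then u i else v i)"
      using that by (subst prod.If_cases) (auto simp: Int_absorb1 Diff_eq)
    then show ?thesis
      by (simp add: altsum_powers[symmetric] altsum_scale_rows[symmetric] if_distrib
               cong: if_cong)
         (auto intro!: altsum_cong)
  qed
  then have "(\<Sum>A\<in>Pow {..<n}. (\<Prod>i\<in>A. u i) * (\<Prod>i\<in>{..<n} - A. v i) *
            vdm n (\<lambda>i. if i \<in> A then Y i else X i))
        = altsum n (\<lambda>i j. u i * Y i ^ j + v i * X i ^ j)"
    by (simp add: altsum_add)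
  also have "\<dots> = altsum n (\<lambda>i j. c i * poly (P j) (X i))"
    by (rule altsum_cong) (rule eq)
  also have "\<dots> = (\<Prod>i<n. c i) * (\<Prod>j<n. poly.coeff (P j) j) * vdm n X"
    by (simp add: altsum_scale_rows altsum_poly_powers[OF deg] altsum_powers mult_ac)
  finally show ?thesis .
qed

section \<open>Pieri and branching rules\<close>

lemma vdm_fps_const: "vdm n (\<lambda>i. fps_const (X i)) = fps_const (vdm n X :: 'a :: comm_ring_1)"
proof -
  have *: "(\<Prod>i<k. fps_const (f i)) = fps_const (\<Prod>i<k. f i)" for f :: "nat \<Rightarrow> 'a" and k
    by (induction k) (auto simp: mult.commute)
  show ?thesis
    by (simp add: vdm_def * )
qed

lemma vdm_eq_0:
  assumes "i < j" "j < n" "X i = X j"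
  shows "vdm n X = (0 :: 'a :: idom)"
proof -
  have "(\<Prod>i<j. X j - X i) = 0"
    using assms by (intro prod_zero) (auto intro!: bexI[of _ i])
  then show ?thesis
    unfolding vdm_def using assms by (intro prod_zero) auto
qed

text \<open>With \<open>X i = q ^ l i\<close>, multiplication by \<open>q\<close> raises
  \<open>l i\<close> by one, so \<open>A\<close> is the set of rows that gain a box. The column
  polynomials are the monomials \<open>(1 + z * q ^ j) * x ^ j\<close>.\<close>

lemma vdm_pieri:
  fixes z q :: "'a :: idom"
  shows "(\<Sum>A\<in>Pow {..<n}. z ^ card A * vdm n (\<lambda>i. if i \<in> A then q * X i else X i))
         = (\<Prod>j<n. 1 + z * q ^ j) * vdm n X"
proof -
  have "(\<Sum>A\<in>Pow {..<n}. (\<Prod>i\<in>A. z) * (\<Prod>i\<in>{..<n} - A. 1) *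
            vdm n (\<lambda>i. if i \<in> A then q * X i else X i))
        = (\<Prod>i<n. 1) * (\<Prod>j<n. poly.coeff (monom (1 + z * q ^ j) j) j) * vdm n X"
    by (rule vdm_two_term_expansion)
       (auto simp: poly_monom degree_monom_le algebra_simps power_mult_distrib)
  then show ?thesis by simp
qed

text \<open>
  The contribution of the row with \<open>l\<^sub>i = l\<close> once the squared Vandermonde product is split off, up to a
  factor independent of \<open>l\<close>.
\<close>

definition row_weight :: "nat \<Rightarrow> complex \<Rightarrow> complex \<Rightarrow> nat \<Rightarrow> complex" where
  "row_weight n q b l = (\<Prod>r<l. q * (b - q ^ Suc r / q ^ n) / (1 - q ^ Suc r))"

text \<open>The factor with \<open>r = n + m - 1\<close> is zero. This cuts the sums off at a finite
  bound when \<open>b\<close> is a power of \<open>q\<close>.\<close>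

lemma row_weight_eq_0:
  assumes "q \<noteq> 0" "n + m \<le> l" "0 < n + m"
  shows "row_weight n q (q ^ m) l = 0"
proof -
  have "q ^ m - q ^ Suc (n + m - 1) / q ^ n = 0"
    using assms by (simp add: power_add field_simps)
  then show ?thesis
    unfolding row_weight_def using assms
    by (intro prod_zero) (auto intro!: bexI[of _ "n + m - 1"])
qed

text \<open>Since \<open>b * q - q ^ Suc r / q ^ n\<close> is \<open>q\<close> times
  \<open>b - q ^ r / q ^ n\<close>, replacing \<open>b\<close> by \<open>b * q\<close> shifts the
  factors by one index. The quotient telescopes, leaving only the two end factors and a power of
  \<open>q\<close>.\<close>

lemma row_weight_shift:
  assumes q: "q \<noteq> 0" and d: "b - 1 / q ^ n \<noteq> 0"
  shows "row_weight n q b l =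
           row_weight n q (b * q) l / (b - 1 / q ^ n) * ((b - q ^ l / q ^ n) / q ^ l)"
proof (induction l)
  case 0
  then show ?case using d by (simp add: row_weight_def)
next
  case (Suc l)
  have *: "b * q - q ^ Suc l / q ^ n = q * (b - q ^ l / q ^ n)"
    using q by (simp add: field_simps)
  show ?case
    using q d Suc unfolding row_weight_def
    by (simp only: prod.lessThan_Suc * ) (simp add: divide_simps)
qed

lemma row_weight_Suc_shift:
  assumes q: "q \<noteq> 0" "\<forall>k\<ge>1. q ^ k \<noteq> 1" and d: "b - 1 / q ^ n \<noteq> 0"
  shows "row_weight n q b l =
           row_weight n q (b * q) (Suc l) / (b - 1 / q ^ n) * ((1 - q ^ Suc l) / (q * q ^ Suc l))"
proof -
  have *: "b * q - q ^ Suc l / q ^ n = q * (b - q ^ l / q ^ n)"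
    using q by (simp add: field_simps)
  have "q ^ Suc l \<noteq> 1" using q(2)[rule_format, of "Suc l"] by simp
  then have 1: "1 - q ^ Suc l \<noteq> 0" by (metis eq_iff_diff_eq_0)
  have 2: "row_weight n q (b * q) (Suc l) =
             row_weight n q (b * q) l * (q * (q * (b - q ^ l / q ^ n)) / (1 - q ^ Suc l))"
    unfolding row_weight_def by (simp only: prod.lessThan_Suc * )
  show ?thesis
    unfolding 2 using q 1 by (subst row_weight_shift[OF q(1) d]) (simp add: divide_simps)
qed

text \<open>The value 0 at \<open>l = 0\<close> says that an entry 0 cannot be lowered; it agrees
  with the factor \<open>1 - q ^ l\<close> in \<open>row_weight_prev_shift\<close>.\<close>

definition row_weight_prev :: "nat \<Rightarrow> complex \<Rightarrow> complex \<Rightarrow> nat \<Rightarrow> complex" where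
  "row_weight_prev n q b l = (if l = 0 then 0 else row_weight n q b (l - 1))"

lemma row_weight_prev_shift:
  assumes q: "q \<noteq> 0" "\<forall>k\<ge>1. q ^ k \<noteq> 1" and d: "b - 1 / q ^ n \<noteq> 0"
  shows "row_weight_prev n q b l =
           row_weight n q (b * q) l / (b - 1 / q ^ n) * ((1 - q ^ l) / (q * q ^ l))"
proof (cases l)
  case (Suc k)
  then show ?thesis
    using row_weight_Suc_shift[OF q d, of k] unfolding row_weight_prev_def by simp
qed (simp add: row_weight_prev_def)

text \<open>
  The coefficient \<open>- b * q\<close> is the one for which the terms with \<open>1 / q ^ l\<close> cancel when \<open>j = 0\<close>,
  so that every column is a polynomial in \<open>q ^ l\<close>.
\<close>

lemma vdm_branching:
  assumes q: "q \<noteq> 0" "\<forall>k\<ge>1. q ^ k \<noteq> 1" and d: "b - 1 / q ^ n \<noteq> 0"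
  shows "(\<Sum>A\<in>Pow {..<n}. (\<Prod>i\<in>A. - b * q * row_weight_prev n q b (l i)) *
            (\<Prod>i\<in>{..<n} - A. row_weight n q b (l i)) *
            vdm n (\<lambda>i. if i \<in> A then q ^ l i / q else q ^ l i))
         = (\<Prod>i<n. row_weight n q (b * q) (l i) / (b - 1 / q ^ n)) *
             (\<Prod>j<n. b / q ^ j - 1 / q ^ n) * vdm n (\<lambda>i. q ^ l i)"
proof -
  \<comment> \<open>The coefficients of \<open>x ^ j\<close> and \<open>x ^ (j - 1)\<close> for
    \<open>x = q ^ l i\<close>, once the common factor of row \<open>i\<close> is removed. At
    \<open>j = 0\<close> the second coefficient is 0, so the truncated \<open>j - 1\<close> does no
    harm.\<close>
  define P where "P j = monom (b / q ^ j - 1 / q ^ n) j + monom (b - b / q ^ j) (j - 1)" for j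
  have "(\<Sum>A\<in>Pow {..<n}. (\<Prod>i\<in>A. - b * q * row_weight_prev n q b (l i)) *
            (\<Prod>i\<in>{..<n} - A. row_weight n q b (l i)) *
            vdm n (\<lambda>i. if i \<in> A then q ^ l i / q else q ^ l i))
         = (\<Prod>i<n. row_weight n q (b * q) (l i) / (b - 1 / q ^ n)) *
             (\<Prod>j<n. poly.coeff (P j) j) * vdm n (\<lambda>i. q ^ l i)"
  proof (rule vdm_two_term_expansion)
    fix i j
    define x where "x = q ^ l i"
    have x: "x \<noteq> 0" using q by (simp add: x_def)
    have "- b * q * ((1 - x) / (q * x)) * (x / q) ^ j + (b - x / q ^ n) / x * x ^ j = poly (P j) x"
      using q x by (cases j) (simp_all add: P_def poly_monom divide_simps, simp_all add: algebra_simps)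
    then have "row_weight n q (b * q) (l i) / (b - 1 / q ^ n) *
       (- b * q * ((1 - x) / (q * x)) * (x / q) ^ j + (b - x / q ^ n) / x * x ^ j) =
       row_weight n q (b * q) (l i) / (b - 1 / q ^ n) * poly (P j) x"
      by simp
    then show "- b * q * row_weight_prev n q b (l i) * (q ^ l i / q) ^ j +
          row_weight n q b (l i) * (q ^ l i) ^ j =
          row_weight n q (b * q) (l i) / (b - 1 / q ^ n) * poly (P j) (q ^ l i)"
      unfolding row_weight_prev_shift[OF q d] row_weight_shift[OF q(1) d] x_def
      by (simp only: algebra_simps)
  next
    fix j :: nat
    show "degree (P j) \<le> j"
      unfolding P_def
      by (intro degree_add_le order.trans[OF degree_monom_le]) auto
  qed
  moreover have "poly.coeff (P j) j = b / q ^ j - 1 / q ^ n" for j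
    by (cases j) (auto simp: P_def)
  ultimately show ?thesis by simp
qed

section \<open>Sums over strictly decreasing sequences\<close>

text \<open>Fixing the value 0 from \<open>n\<close> on makes a sequence determined by its first
  \<open>n\<close> entries, so the set is finite and admits bijective reindexing.\<close>

definition strict_seqs :: "nat \<Rightarrow> nat \<Rightarrow> (nat \<Rightarrow> nat) set" where
  "strict_seqs n M =
     {l. (\<forall>i\<ge>n. l i = 0) \<and> (\<forall>i<n. l i < M) \<and> (\<forall>i j. i < j \<and> j < n \<longrightarrow> l j < l i)}"

lemma finite_strict_seqs: "finite (strict_seqs n M)"
proof (rule finite_subset)
  show "strict_seqs n M \<subseteq> {l. \<forall>i. (i \<in> {..<n} \<longrightarrow> l i \<in> {..<M}) \<and> (i \<notin> {..<n} \<longrightarrow> l i = 0)}"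
    by (auto simp: strict_seqs_def)
qed (intro finite_set_of_finite_funs; simp)

text \<open>The least strictly decreasing sequence of length \<open>n\<close>; it corresponds to the
  empty partition.\<close>

definition staircase :: "nat \<Rightarrow> nat \<Rightarrow> nat" where
  "staircase n i = n - 1 - i"

lemma strict_seqs_ge:
  assumes "l \<in> strict_seqs n M" "i < n"
  shows "staircase n i \<le> l i"
proof -
  have "i = n - 1 - k \<Longrightarrow> k < n \<Longrightarrow> k \<le> l i" for k i
  proof (induction k arbitrary: i)
    case (Suc k)
    have "k \<le> l (n - 1 - k)" using Suc by simp
    moreover have "l (n - 1 - k) < l i"
      using assms(1) Suc.prems by (auto simp: strict_seqs_def)
    ultimately show ?case by simp
  qed simp
  from this[of i "n - 1 - i"] show ?thesis
    using assms(2) by (simp add: staircase_def)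
qed

lemma strict_seqs_eq_staircase:
  assumes l: "l \<in> strict_seqs n M" and bound: "\<And>i. i < n \<Longrightarrow> l i < n"
  shows "l = staircase n"
proof
  fix i
  have "i < n \<Longrightarrow> l i \<le> staircase n i" for i
  proof (induction i)
    case 0
    then show ?case using bound[of 0] by (simp add: staircase_def)
  next
    case (Suc i)
    have "l (Suc i) < l i" using l Suc.prems by (auto simp: strict_seqs_def)
    then show ?case using Suc by (simp add: staircase_def)
  qed
  then show "l i = staircase n i"
    using strict_seqs_ge[OF l, of i] l
    by (cases "i < n") (auto simp: strict_seqs_def staircase_def intro: antisym)
qed

lemma staircase_in_strict_seqs: "n \<le> M \<Longrightarrow> staircase n \<in> strict_seqs n M"
  by (auto simp: strict_seqs_def staircase_def)

text \<open>Only one of the two Vandermonde factors is included. The branching rule acts on this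
  product, while the other factor is left for the Pieri rule.\<close>

definition shape_weight :: "nat \<Rightarrow> complex \<Rightarrow> complex \<Rightarrow> (nat \<Rightarrow> nat) \<Rightarrow> complex" where
  "shape_weight n q b l = (\<Prod>i<n. row_weight n q b (l i)) * vdm n (\<lambda>i. q ^ l i)"

lemma shape_weight_tie:
  assumes "i < j" "j < n" "l i = l j"
  shows "shape_weight n q b l = 0"
  unfolding shape_weight_def using vdm_eq_0[OF assms(1,2), of "\<lambda>i. q ^ l i"] assms by simp

lemma shape_weight_large:
  assumes "q \<noteq> 0" "i < n" "n + m \<le> l i"
  shows "shape_weight n q (q ^ m) l = 0"
  unfolding shape_weight_def
  using row_weight_eq_0[OF assms(1,3)] assms by (auto intro!: prod_zero bexI[of _ i])

text \<open>This is \<open>vdm_branching\<close> in terms of sequences, with \<open>A\<close> the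
  set of entries lowered by one. The case distinction discards the terms in which
  \<open>l i - 1\<close> would be truncated; there \<open>row_weight_prev\<close> is 0.\<close>

lemma shape_weight_branching:
  assumes q: "q \<noteq> 0" "\<forall>k\<ge>1. q ^ k \<noteq> 1" and d: "b - 1 / q ^ n \<noteq> 0"
  shows "(\<Sum>A\<in>Pow {..<n}. if \<exists>i\<in>A. l i = 0 then 0 else
            (- b * q) ^ card A * shape_weight n q b (\<lambda>i. if i \<in> A then l i - 1 else l i))
         = (\<Prod>j<n. (b / q ^ j - 1 / q ^ n) / (b - 1 / q ^ n)) * shape_weight n q (b * q) l"
proof -
  have "(if \<exists>i\<in>A. l i = 0 then 0 else
            (- b * q) ^ card A * shape_weight n q b (\<lambda>i. if i \<in> A then l i - 1 else l i)) =
        (\<Prod>i\<in>A. - b * q * row_weight_prev n q b (l i)) *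
            (\<Prod>i\<in>{..<n} - A. row_weight n q b (l i)) *
            vdm n (\<lambda>i. if i \<in> A then q ^ l i / q else q ^ l i)"
    if A: "A \<in> Pow {..<n}" for A
  proof (cases "\<exists>i\<in>A. l i = 0")
    case True
    have "finite A" using A finite_subset by auto
    moreover obtain i where "i \<in> A" "row_weight_prev n q b (l i) = 0"
      using True by (auto simp: row_weight_prev_def)
    ultimately have "(\<Prod>i\<in>A. - b * q * row_weight_prev n q b (l i)) = 0"
      by (intro prod_zero) auto
    with True show ?thesis by simp
  next
    case False
    have "(\<Prod>i<n. row_weight n q b (if i \<in> A then l i - 1 else l i)) =
          (\<Prod>i<n. if i \<in> A then row_weight_prev n q b (l i) else row_weight n q b (l i))"
      using False by (intro prod.cong) (auto simp: row_weight_prev_def)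
    also have "\<dots> = (\<Prod>i\<in>A. row_weight_prev n q b (l i)) *
            (\<Prod>i\<in>{..<n} - A. row_weight n q b (l i))"
      using A by (subst prod.If_cases) (auto simp: Int_absorb1 Diff_eq)
    finally have 1: "(\<Prod>i<n. row_weight n q b (if i \<in> A then l i - 1 else l i)) = \<dots>" .
    have 2: "(\<lambda>i. q ^ (if i \<in> A then l i - 1 else l i)) = (\<lambda>i. if i \<in> A then q ^ l i / q else q ^ l i)"
    proof
      fix i
      show "q ^ (if i \<in> A then l i - 1 else l i) = (if i \<in> A then q ^ l i / q else q ^ l i)"
        using False q by (cases "l i") auto
    qed
    have 3: "(\<Prod>i\<in>A. - b * q * row_weight_prev n q b (l i)) =
       (- b * q) ^ card A * (\<Prod>i\<in>A. row_weight_prev n q b (l i))"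
      by (subst prod.distrib) simp
    show ?thesis
      unfolding if_not_P[OF False] shape_weight_def 1 2 3 by (simp only: mult.assoc)
  qed
  then have "(\<Sum>A\<in>Pow {..<n}. if \<exists>i\<in>A. l i = 0 then 0 else
            (- b * q) ^ card A * shape_weight n q b (\<lambda>i. if i \<in> A then l i - 1 else l i)) =
       (\<Prod>i<n. row_weight n q (b * q) (l i) / (b - 1 / q ^ n)) *
             (\<Prod>j<n. b / q ^ j - 1 / q ^ n) * vdm n (\<lambda>i. q ^ l i)"
    by (subst vdm_branching[OF q d, symmetric]) (rule sum.cong, simp, simp)
  then show ?thesis
    by (simp add: shape_weight_def prod_dividef mult_ac)
qed

lemma fps_const_sum: "fps_const (sum f A) = (\<Sum>x\<in>A. fps_const (f x))"
  by (induction A rule: infinite_finite_induct) (auto simp flip: fps_const_add)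

lemma vdm_pieri_fps:
  fixes q c :: "'a :: idom"
  shows "(\<Sum>A\<in>Pow {..<n}. fps_const (c ^ card A * vdm n (\<lambda>i. q ^ (if i \<in> A then l i + 1 else l i)))
            * fps_X ^ card A)
         = (\<Prod>j<n. 1 + fps_X * fps_const (c * q ^ j)) * fps_const (vdm n (\<lambda>i. q ^ l i))"
proof -
  have *: "(fps_const c * fps_X) ^ k * fps_const v = fps_const (c ^ k * v) * fps_X ^ k" for k v
    by (simp add: power_mult_distrib mult_ac flip: fps_const_mult)
  have "(\<Sum>A\<in>Pow {..<n}. (fps_const c * fps_X) ^ card A *
            vdm n (\<lambda>i. if i \<in> A then fps_const q * fps_const (q ^ l i) else fps_const (q ^ l i)))
         = (\<Prod>j<n. 1 + fps_const c * fps_X * fps_const q ^ j) * vdm n (\<lambda>i. fps_const (q ^ l i))"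
    by (rule vdm_pieri)
  moreover have "(\<lambda>i. if i \<in> A then fps_const q * fps_const (q ^ l i) else fps_const (q ^ l i)) =
     (\<lambda>i. fps_const (q ^ (if i \<in> A then l i + 1 else l i)))" for A
    by auto
  moreover have "fps_const c * fps_X * fps_const q ^ j = fps_X * fps_const (c * q ^ j)" for j
    by (simp add: mult_ac flip: fps_const_mult)
  ultimately show ?thesis
    by (simp only: vdm_fps_const * )
qed

text \<open>The exponent of Q is the sum of the entries, which exceeds |\<mu>| by the sum of the
  staircase.\<close>

definition shape_sum :: "nat \<Rightarrow> nat \<Rightarrow> complex \<Rightarrow> complex \<Rightarrow> complex fps" where
  "shape_sum n M q b = (\<Sum>l\<in>strict_seqs n M.
     fps_const (vdm n (\<lambda>i. q ^ l i) * shape_weight n q b l) * fps_X ^ (\<Sum>i<n. l i))"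

text \<open>Double counting of pairs of a larger and a smaller sequence whose entries differ by at
  most one. The branching rule expands the weight at \<open>b * q\<close> of the larger one over the
  smaller ones; after reindexing, the Pieri rule sums the Vandermonde factor of the larger
  one.\<close>

lemma shape_sum_step:
  fixes m n M :: nat and q :: complex
  defines "b \<equiv> q ^ m"
  assumes q: "q \<noteq> 0" "\<forall>k\<ge>1. q ^ k \<noteq> 1" and d: "b - 1 / q ^ n \<noteq> 0" and M: "n + m < M"
  shows "fps_const (\<Prod>j<n. (b / q ^ j - 1 / q ^ n) / (b - 1 / q ^ n)) * shape_sum n M q (b * q) =
         (\<Prod>j<n. 1 - fps_X * fps_const (b * q ^ Suc j)) * shape_sum n M q b"
proof -
  let ?L = "strict_seqs n M" and ?P = "Pow {..<n}"
  define V where "V l = vdm n (\<lambda>i. q ^ l i)" for l :: "nat \<Rightarrow> nat"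
  define dn where "dn A l = (\<lambda>i. if i \<in> A then l i - 1 else l i)" for A and l :: "nat \<Rightarrow> nat"
  define up where "up A l = (\<lambda>i. if i \<in> A then l i + 1 else l i)" for A and l :: "nat \<Rightarrow> nat"
  \<comment> \<open>In \<open>f\<close> the sequence \<open>l\<close> is the larger one and
    \<open>A\<close> marks the entries to lower; in \<open>g\<close> it is the smaller one and
    \<open>A\<close> marks the entries to raise.\<close>
  define f where "f l A = fps_const (V l * (if \<exists>i\<in>A. l i = 0 then 0 else
      (- b * q) ^ card A * shape_weight n q b (dn A l))) * fps_X ^ (\<Sum>i<n. l i)" for l A
  define g where "g l A = fps_const (V (up A l) * ((- b * q) ^ card A * shape_weight n q b l))
      * fps_X ^ (\<Sum>i<n. up A l i)" for l A
  have fin: "finite (?L \<times> ?P)" by (simp add: finite_strict_seqs)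
  have V_tie: "V l = 0" if "i < j" "j < n" "l i = l j" for l i j
    unfolding V_def using vdm_eq_0[OF that(1,2), of "\<lambda>i. q ^ l i"] that(3) by simp
  \<comment> \<open>Lowering entries by at most one can break strict decrease only by creating a
    tie, and \<open>shape_weight\<close> vanishes at ties.\<close>
  have f0: "f l A = 0" if l: "l \<in> ?L" and "(\<exists>i\<in>A. l i = 0) \<or> dn A l \<notin> ?L" for l A
  proof (cases "\<exists>i\<in>A. l i = 0")
    case False
    then have "dn A l \<notin> ?L" using that(2) by blast
    moreover have "\<forall>i\<ge>n. dn A l i = 0" "\<forall>i<n. dn A l i < M"
      using l by (auto simp: dn_def strict_seqs_def less_imp_diff_less)
    ultimately obtain i j where ij: "i < j" "j < n" "\<not> dn A l j < dn A l i"
      by (auto simp: strict_seqs_def)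
    moreover have "l j < l i" using l ij by (auto simp: strict_seqs_def)
    ultimately have "dn A l i = dn A l j"
      using False by (auto simp: dn_def split: if_splits)
    from shape_weight_tie[OF ij(1,2) this] show ?thesis by (simp add: f_def)
  qed (simp add: f_def)
  \<comment> \<open>Raising fails either at the bound \<open>M\<close>, when some entry was already
    at least \<open>n + m\<close> and \<open>shape_weight\<close> is 0, or by creating a tie, when
    \<open>V\<close> is 0.\<close>
  have g0: "g l A = 0" if l: "l \<in> ?L" and A: "A \<in> ?P" and up: "up A l \<notin> ?L" for l A
  proof (cases "\<exists>i<n. \<not> up A l i < M")
    case True
    then obtain i where i: "i < n" "\<not> up A l i < M" by blast
    then have "n + m \<le> l i" using M by (auto simp: up_def split: if_splits)
    then have "shape_weight n q b l = 0"
      unfolding b_def using shape_weight_large q(1) i(1) by blast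
    then show ?thesis by (simp add: g_def)
  next
    case False
    moreover have "\<forall>i\<ge>n. up A l i = 0"
      using l A by (auto simp: up_def strict_seqs_def)
    ultimately obtain i j where ij: "i < j" "j < n" "\<not> up A l j < up A l i"
      using up by (auto simp: strict_seqs_def)
    moreover have "l j < l i" using l ij by (auto simp: strict_seqs_def)
    ultimately have "up A l i = up A l j"
      by (auto simp: up_def split: if_splits)
    from V_tie[OF ij(1,2) this] show ?thesis by (simp add: g_def)
  qed
  have up_dn: "up A (dn A l) = l" if "\<not> (\<exists>i\<in>A. l i = 0)" for A l
    using that by (auto simp: up_def dn_def fun_eq_iff)
  have dn_up: "dn A (up A l) = l" for A l
    by (auto simp: up_def dn_def fun_eq_iff)
  have "fps_const (\<Prod>j<n. (b / q ^ j - 1 / q ^ n) / (b - 1 / q ^ n)) * shape_sum n M q (b * q) =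
        (\<Sum>l\<in>?L. fps_const (V l * ((\<Prod>j<n. (b / q ^ j - 1 / q ^ n) / (b - 1 / q ^ n)) *
            shape_weight n q (b * q) l)) * fps_X ^ (\<Sum>i<n. l i))"
    unfolding shape_sum_def V_def sum_distrib_left
    by (intro sum.cong refl) (simp add: mult_ac flip: fps_const_mult)
  also have "\<dots> = (\<Sum>l\<in>?L. \<Sum>A\<in>?P. f l A)"
    unfolding shape_weight_branching[OF q d, symmetric] f_def dn_def sum_distrib_left
      fps_const_sum sum_distrib_right ..
  also have "\<dots> = (\<Sum>(l, A)\<in>?L \<times> ?P. f l A)"
    by (rule sum.cartesian_product)
  \<comment> \<open>Only pairs with a valid lowered sequence remain; on these \<open>dn\<close> and
    \<open>up\<close> are inverse to each other and carry \<open>f\<close> to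
    \<open>g\<close>.\<close>
  also have "\<dots> = (\<Sum>(l, A)\<in>{(l, A)\<in>?L \<times> ?P. \<not> (\<exists>i\<in>A. l i = 0) \<and> dn A l \<in> ?L}. f l A)"
    by (intro sum.mono_neutral_right fin) (auto split: prod.splits intro!: f0)
  also have "\<dots> = (\<Sum>(l, A)\<in>{(l, A)\<in>?L \<times> ?P. up A l \<in> ?L}. g l A)"
  proof (rule sum.reindex_bij_witness
      [where j = "\<lambda>(l, A). (dn A l, A)" and i = "\<lambda>(l, A). (up A l, A)"])
    fix x assume x: "x \<in> {(l, A)\<in>?L \<times> ?P. \<not> (\<exists>i\<in>A. l i = 0) \<and> dn A l \<in> ?L}"
    obtain l A where [simp]: "x = (l, A)" by (cases x)
    have *: "up A (dn A l) = l" using x by (intro up_dn) auto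
    show "(\<lambda>(l, A). (up A l, A)) ((\<lambda>(l, A). (dn A l, A)) x) = x"
         "(\<lambda>(l, A). (dn A l, A)) x \<in> {(l, A)\<in>?L \<times> ?P. up A l \<in> ?L}"
      using x by (auto simp: * )
    have "\<not> (\<exists>i\<in>A. l i = 0)" using x by auto
    then have "f l A = fps_const (V l * ((- b * q) ^ card A * shape_weight n q b (dn A l)))
        * fps_X ^ (\<Sum>i<n. l i)"
      unfolding f_def by (simp only: if_False)
    then show "(case (\<lambda>(l, A). (dn A l, A)) x of (l, A) \<Rightarrow> g l A) = (case x of (l, A) \<Rightarrow> f l A)"
      by (simp add: g_def * )
  next
    fix x assume x: "x \<in> {(l, A)\<in>?L \<times> ?P. up A l \<in> ?L}"
    obtain l A where [simp]: "x = (l, A)" by (cases x)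
    show "(\<lambda>(l, A). (dn A l, A)) ((\<lambda>(l, A). (up A l, A)) x) = x"
         "(\<lambda>(l, A). (up A l, A)) x \<in>
            {(l, A)\<in>?L \<times> ?P. \<not> (\<exists>i\<in>A. l i = 0) \<and> dn A l \<in> ?L}"
      using x dn_up[of A l] by (auto simp: up_def)
  qed
  also have "\<dots> = (\<Sum>(l, A)\<in>?L \<times> ?P. g l A)"
    by (intro sum.mono_neutral_left fin) (auto split: prod.splits intro!: g0)
  also have "\<dots> = (\<Sum>l\<in>?L. \<Sum>A\<in>?P. g l A)"
    by (rule sum.cartesian_product[symmetric])
  also have "\<dots> = (\<Sum>l\<in>?L. (\<Prod>j<n. 1 - fps_X * fps_const (b * q ^ Suc j)) *
      (fps_const (V l * shape_weight n q b l) * fps_X ^ (\<Sum>i<n. l i)))"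
  proof (rule sum.cong)
    fix l
    have *: "(\<Sum>i<n. up A l i) = (\<Sum>i<n. l i) + card A" if "A \<in> ?P" for A
    proof -
      have "(\<Sum>i<n. up A l i) = (\<Sum>i<n. l i + (if i \<in> A then 1 else 0))"
        by (rule sum.cong) (auto simp: up_def)
      also have "\<dots> = (\<Sum>i<n. l i) + card A"
        using that by (simp add: sum.distrib sum.If_cases Int_absorb1)
      finally show ?thesis .
    qed
    have "(\<Sum>A\<in>?P. g l A) = fps_const (shape_weight n q b l) * fps_X ^ (\<Sum>i<n. l i) *
       (\<Sum>A\<in>?P. fps_const ((- b * q) ^ card A * vdm n (\<lambda>i. q ^ (if i \<in> A then l i + 1 else l i)))
            * fps_X ^ card A)"
      unfolding sum_distrib_left
      by (intro sum.cong refl)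
         (simp only: g_def * power_add, simp add: V_def up_def mult_ac flip: fps_const_mult)
    also have "\<dots> = (\<Prod>j<n. 1 - fps_X * fps_const (b * q ^ Suc j)) *
      (fps_const (V l * shape_weight n q b l) * fps_X ^ (\<Sum>i<n. l i))"
      by (subst vdm_pieri_fps) (simp add: V_def mult_ac flip: fps_const_mult fps_const_neg)
    finally show "(\<Sum>A\<in>?P. g l A) = \<dots>" .
  qed simp
  also have "\<dots> = (\<Prod>j<n. 1 - fps_X * fps_const (b * q ^ Suc j)) * shape_sum n M q b"
    by (simp add: shape_sum_def V_def sum_distrib_left)
  finally show ?thesis .
qed

text \<open>Induction on \<open>m\<close> from \<open>b = 1\<close>, where every sequence but the
  staircase has weight 0. The constant stays existential here; comparing coefficients of Q^0
  determines it later.\<close>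

lemma shape_sum_closed_form:
  assumes q: "q \<noteq> 0" "\<forall>k\<ge>1. q ^ k \<noteq> 1" and M: "n + m < M"
  shows "\<exists>c. shape_sum n M q (q ^ m) = fps_const c * fps_X ^ (\<Sum>i<n. staircase n i) *
           (\<Prod>i<m. \<Prod>j<n. 1 - fps_X * fps_const (q ^ (i + j + 1)))"
  using M
proof (induction m)
  case 0
  have "shape_sum n M q (q ^ 0) = (\<Sum>l\<in>{staircase n}.
     fps_const (vdm n (\<lambda>i. q ^ l i) * shape_weight n q (q ^ 0) l) * fps_X ^ (\<Sum>i<n. l i))"
    unfolding shape_sum_def
  proof (rule sum.mono_neutral_right)
    show "\<forall>l\<in>strict_seqs n M - {staircase n}.
       fps_const (vdm n (\<lambda>i. q ^ l i) * shape_weight n q (q ^ 0) l) * fps_X ^ (\<Sum>i<n. l i) = 0"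
    proof
      fix l assume "l \<in> strict_seqs n M - {staircase n}"
      then obtain i where "i < n" "n + 0 \<le> l i"
        using strict_seqs_eq_staircase[of l n M] by force
      then have "shape_weight n q (q ^ 0) l = 0"
        using shape_weight_large[OF q(1)] by blast
      then show "fps_const (vdm n (\<lambda>i. q ^ l i) * shape_weight n q (q ^ 0) l) * fps_X ^ (\<Sum>i<n. l i) = 0"
        by simp
    qed
  qed (use 0 staircase_in_strict_seqs finite_strict_seqs in auto)
  then show ?case by auto
next
  case (Suc m)
  then obtain c where c: "shape_sum n M q (q ^ m) = fps_const c * fps_X ^ (\<Sum>i<n. staircase n i) *
           (\<Prod>i<m. \<Prod>j<n. 1 - fps_X * fps_const (q ^ (i + j + 1)))"
    by auto
  \<comment> \<open>The case \<open>n = 0\<close> is separate because the denominator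
    \<open>q ^ m - 1 / q ^ n\<close> of the step is 0 when also \<open>m = 0\<close>.\<close>
  show ?case
  proof (cases "n = 0")
    case True
    have "strict_seqs 0 M = {\<lambda>_. 0}" by (auto simp: strict_seqs_def)
    with True show ?thesis
      by (intro exI[of _ 1]) (simp add: shape_sum_def shape_weight_def vdm_def)
  next
    case False
    have d: "q ^ m / q ^ j - 1 / q ^ n \<noteq> 0" if "j < n" for j
    proof
      assume "q ^ m / q ^ j - 1 / q ^ n = 0"
      then have "q ^ (m + n) = q ^ j" using q(1) by (simp add: field_simps power_add)
      moreover have "q ^ (m + n) = q ^ j * q ^ (m + n - j)"
        using that by (simp flip: power_add)
      ultimately show False using q that by simp
    qed
    define C where "C = (\<Prod>j<n. (q ^ m / q ^ j - 1 / q ^ n) / (q ^ m - 1 / q ^ n))"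
    define R where "R = (\<Prod>j<n. 1 - fps_X * fps_const (q ^ m * q ^ Suc j))"
    have C: "C \<noteq> 0" using d d[of 0] False by (auto simp: C_def)
    have "shape_sum n M q (q ^ Suc m) =
       fps_const (1 / C) * (fps_const C * shape_sum n M q (q ^ m * q))"
      using C by (simp add: mult.commute flip: mult.assoc)
    also have "fps_const C * shape_sum n M q (q ^ m * q) = R * shape_sum n M q (q ^ m)"
      unfolding C_def R_def using d[of 0] False Suc.prems by (intro shape_sum_step q) auto
    also have "R = (\<Prod>j<n. 1 - fps_X * fps_const (q ^ (m + j + 1)))"
      by (simp add: R_def power_add mult_ac)
    finally have "shape_sum n M q (q ^ Suc m) =
       fps_const (1 / C * c) * fps_X ^ (\<Sum>i<n. staircase n i) *
           (\<Prod>i<Suc m. \<Prod>j<n. 1 - fps_X * fps_const (q ^ (i + j + 1)))"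
      unfolding c fps_const_mult[symmetric] by (simp only: prod.lessThan_Suc mult_ac)
    then show ?thesis by blast
  qed
qed

section \<open>Hooks and contents of partitions\<close>

lemma part_antimono:
  assumes "is_partition \<mu>" "1 \<le> i" "i \<le> j"
  shows "part \<mu> j \<le> part \<mu> i"
  using assms sorted_wrt_nth_less[of "(\<ge>)" \<mu> "i - 1" "j - 1"]
  by (cases "i = j") (auto simp: part_def is_partition_def)

lemma part_pos: "is_partition \<mu> \<Longrightarrow> 1 \<le> i \<Longrightarrow> i \<le> length \<mu> \<Longrightarrow> 0 < part \<mu> i"
  by (auto simp: part_def is_partition_def)

text \<open>Rows may be counted up to any \<open>n\<close> beyond the length, since absent rows have
  part 0 and \<open>1 \<le> j\<close>. For \<open>j\<close> beyond the first part, the default value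
  0 of \<open>part\<close> matches the empty set.\<close>

lemma part_transposed:
  assumes "is_partition \<mu>" "length \<mu> \<le> n" "1 \<le> j"
  shows "part (transposed \<mu>) j = card {i. i < n \<and> j \<le> part \<mu> (Suc i)}"
proof -
  have "length (filter (\<lambda>m. j \<le> m) \<mu>) = card {i. i < length \<mu> \<and> j \<le> \<mu> ! i}"
    by (rule length_filter_conv_card)
  also have "{i. i < length \<mu> \<and> j \<le> \<mu> ! i} = {i. i < n \<and> j \<le> part \<mu> (Suc i)}"
    using assms by (auto simp: part_def split: if_splits)
  finally have *: "length (filter (\<lambda>m. j \<le> m) \<mu>) = card {i. i < n \<and> j \<le> part \<mu> (Suc i)}" .
  show ?thesis
  proof (cases "j \<le> part \<mu> 1")
    case True
    then show ?thesis
      unfolding *[symmetric] using assms(3)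
      by (cases \<mu>) (auto simp: part_def transposed_def nth_upt simp del: upt_Suc)
  next
    case False
    then have "{i. i < n \<and> j \<le> part \<mu> (Suc i)} = {}"
      using part_antimono[OF assms(1), of 1 "Suc i" for i] order.trans by fastforce
    with False show ?thesis by (simp add: part_def transposed_def)
  qed
qed

lemma boxes_image:
  assumes "length \<mu> \<le> n"
  shows "boxes \<mu> = (\<lambda>(i, j). (Suc i, j)) ` (SIGMA i:{..<n}. {1..part \<mu> (Suc i)})"
proof -
  have "(a, b) \<in> (\<lambda>(i, j). (Suc i, j)) ` (SIGMA i:{..<n}. {1..part \<mu> (Suc i)})"
    if "(a, b) \<in> boxes \<mu>" for a b
    using that assms by (intro image_eqI[of _ _ "(a - 1, b)"]) (auto simp: boxes_def)
  then show ?thesis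
    using assms by (auto simp: boxes_def part_def split: if_splits)
qed

lemma finite_boxes [simp]: "finite (boxes \<mu>)"
  using boxes_image[of \<mu> "length \<mu>"] by simp

lemma prod_boxes:
  assumes "length \<mu> \<le> n"
  shows "(\<Prod>x\<in>boxes \<mu>. f x) = (\<Prod>i<n. \<Prod>j=1..part \<mu> (Suc i). f (Suc i, j))"
  unfolding boxes_image[OF assms]
  by (subst prod.reindex) (auto simp: prod.Sigma case_prod_unfold inj_on_def)

lemma sum_part:
  assumes "length \<mu> \<le> n"
  shows "(\<Sum>i<n. part \<mu> (Suc i)) = sum_list \<mu>"
proof -
  have "(\<Sum>i<n. part \<mu> (Suc i)) = (\<Sum>i<length \<mu>. part \<mu> (Suc i))"
    using assms by (intro sum.mono_neutral_right) (auto simp: part_def)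
  then show ?thesis
    by (simp add: sum_list_sum_nth atLeast0LessThan part_def)
qed

lemma card_boxes: "card (boxes \<mu>) = sum_list \<mu>"
proof -
  have "card (boxes \<mu>) = card (SIGMA i:{..<length \<mu>}. {1..part \<mu> (Suc i)})"
    unfolding boxes_image[OF order.refl] by (rule card_image) (auto simp: inj_on_def)
  then show ?thesis
    by (simp add: sum_part)
qed

text \<open>Both sides multiply \<open>g\<close> over the integers from \<open>d - r\<close> to
  \<open>d\<close>.\<close>

lemma prod_telescope_shift:
  fixes g :: "nat \<Rightarrow> 'a :: comm_monoid_mult"
  assumes "r \<le> d"
  shows "(\<Prod>j=1..r. g (d - j + 1)) * g (d - r) = (\<Prod>j=1..r. g (d - j)) * g d"
  using assms by (induction r) (auto simp: mult_ac Suc_diff_Suc)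

text \<open>
  The hook lengths of row \<open>i\<close> and the differences \<open>l\<^sub>i - l\<^sub>i\<^sub>'\<close> together are \<open>1, \<dots>, l\<^sub>i\<close>: appending
  a new shortest row only replaces an initial segment of the hook lengths by its shift.
\<close>

lemma prod_row_hooks:
  fixes g :: "nat \<Rightarrow> 'a :: comm_monoid_mult" and p :: "nat \<Rightarrow> nat"
  assumes p: "\<And>i j. i \<le> j \<Longrightarrow> p j \<le> p i" and "i < n"
  shows "(\<Prod>j=1..p i. g (p i - j + 1 + card {k\<in>{i<..<n}. j \<le> p k})) *
         (\<Prod>k\<in>{i<..<n}. g (p i + (k - i) - p k)) = (\<Prod>k=1..p i + (n - 1 - i). g k)"
proof -
  from \<open>i < n\<close> have "Suc i \<le> n" by simp
  then show ?thesis
  proof (induction n rule: dec_induct)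
    case base
    have "{k. i < k \<and> k < Suc i \<and> j \<le> p k} = {}" "{i<..<Suc i} = {}" for j by auto
    then show ?case
      using prod.atLeastAtMost_rev[of "\<lambda>j. g (p i - j + 1)" 1 "p i"] by auto
  next
    case (step n)
    \<comment> \<open>\<open>?h n j\<close> is the hook length of column \<open>j\<close> in row
      \<open>i\<close> when the rows are those below \<open>n\<close>. The new row reaches the
      columns up to \<open>p n\<close>, where hook lengths grow by one; in the other columns they
      are unchanged.\<close>
    let ?h = "\<lambda>n j. p i - j + 1 + card {k\<in>{i<..<n}. j \<le> p k}"
    let ?d = "p i + (n - i)"
    have ins: "{i<..<Suc n} = insert n {i<..<n}" using step by auto
    have pn: "p n \<le> p i" using p step by simp
    have split: "{1..p i} = {1..p n} \<union> {p n<..p i}" "{1..p n} \<inter> {p n<..p i} = {}"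
      using pn by auto
    have low: "{k\<in>{i<..<m}. j \<le> p k} = {i<..<m}" if "j \<in> {1..p n}" "m \<le> Suc n" for j m
      using that p[of _ n] by (auto intro: order.trans)
    have high: "{k\<in>{i<..<Suc n}. j \<le> p k} = {k\<in>{i<..<n}. j \<le> p k}" if "j \<in> {p n<..p i}" for j
      using that by (auto simp: less_Suc_eq)
    have 1: "(\<Prod>j=1..p n. g (?h (Suc n) j)) = (\<Prod>j=1..p n. g (?d - j + 1))"
      using step pn by (intro prod.cong arg_cong[where f = g] refl) (subst low, auto)
    have 2: "(\<Prod>j=1..p n. g (?h n j)) = (\<Prod>j=1..p n. g (?d - j))"
      using step pn by (intro prod.cong arg_cong[where f = g] refl) (subst low, auto)
    have 3: "(\<Prod>j\<in>{p n<..p i}. g (?h (Suc n) j)) = (\<Prod>j\<in>{p n<..p i}. g (?h n j))"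
      by (intro prod.cong refl) (simp only: high)
    have 4: "(\<Prod>k\<in>{i<..<Suc n}. g (p i + (k - i) - p k)) =
        g (?d - p n) * (\<Prod>k\<in>{i<..<n}. g (p i + (k - i) - p k))"
      by (simp add: ins)
    have sp: "(\<Prod>j=1..p i. F j) = (\<Prod>j=1..p n. F j) * (\<Prod>j\<in>{p n<..p i}. F j)"
      for F :: "nat \<Rightarrow> 'a"
      by (subst split(1), rule prod.union_disjoint) (use split(2) in auto)
    have tele: "(\<Prod>j=1..p n. g (?d - j + 1)) * g (?d - p n) = (\<Prod>j=1..p n. g (?d - j)) * g ?d"
      using pn by (intro prod_telescope_shift) simp
    have "(\<Prod>j=1..p i. g (?h (Suc n) j)) * (\<Prod>k\<in>{i<..<Suc n}. g (p i + (k - i) - p k)) =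
          (\<Prod>j=1..p n. g (?d - j + 1)) * g (?d - p n) * (\<Prod>j\<in>{p n<..p i}. g (?h n j))
          * (\<Prod>k\<in>{i<..<n}. g (p i + (k - i) - p k))"
      unfolding sp 1 3 4 by (simp only: mult_ac)
    also have "\<dots> = (\<Prod>j=1..p i. g (?h n j)) * (\<Prod>k\<in>{i<..<n}. g (p i + (k - i) - p k)) * g ?d"
      unfolding tele sp 2 by (simp only: mult_ac)
    also have "\<dots> = (\<Prod>k=1..p i + (n - 1 - i). g k) * g ?d"
      by (simp only: step.IH)
    also have "?d = Suc (p i + (n - 1 - i))" using step by simp
    also have "(\<Prod>k=1..p i + (n - 1 - i). g k) * g (Suc (p i + (n - 1 - i))) =
        (\<Prod>k=1..p i + (Suc n - 1 - i). g k)"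
    proof -
      have "p i + (Suc n - 1 - i) = Suc (p i + (n - 1 - i))" using step by simp
      then show ?thesis by (simp add: mult.commute)
    qed
    finally show ?case .
  qed
qed

text \<open>The beta numbers of \<mu>, padded with empty rows up to \<open>n\<close>. For
  \<open>n = length \<mu>\<close> they are the hook lengths of the first column of a
  partition.\<close>

definition beta_seq :: "nat \<Rightarrow> nat list \<Rightarrow> nat \<Rightarrow> nat" where
  "beta_seq n \<mu> i = (if i < n then part \<mu> (Suc i) + staircase n i else 0)"

text \<open>All rows above row \<open>i\<close> reach column \<open>j\<close> too, so the column
  length is \<open>Suc i\<close> plus the leg. The result has the form required by
  \<open>prod_row_hooks\<close>.\<close>

lemma hook_eq:
  assumes \<mu>: "is_partition \<mu>" "length \<mu> \<le> n" and i: "i < n" and j: "1 \<le> j" "j \<le> part \<mu> (Suc i)"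
  shows "hook \<mu> (Suc i, j) =
           int (part \<mu> (Suc i) - j + 1 + card {k\<in>{i<..<n}. j \<le> part \<mu> (Suc k)})"
proof -
  have "{k. k < n \<and> j \<le> part \<mu> (Suc k)} = {..i} \<union> {k\<in>{i<..<n}. j \<le> part \<mu> (Suc k)}"
  proof -
    have "j \<le> part \<mu> (Suc k)" if "k \<le> i" for k
      using part_antimono[OF \<mu>(1), of "Suc k" "Suc i"] that j by simp
    then show ?thesis using i by auto
  qed
  moreover have "card ({..i} \<union> {k\<in>{i<..<n}. j \<le> part \<mu> (Suc k)}) =
      card {..i} + card {k\<in>{i<..<n}. j \<le> part \<mu> (Suc k)}"
    by (rule card_Un_disjoint) auto
  ultimately have "card {k. k < n \<and> j \<le> part \<mu> (Suc k)} =
      Suc i + card {k\<in>{i<..<n}. j \<le> part \<mu> (Suc k)}"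
    by (metis card_atMost)
  then show ?thesis
    using j by (simp add: hook_def part_transposed[OF \<mu> j(1)])
qed

text \<open>The hook formula in multiplicative form, obtained row by row from
  \<open>prod_row_hooks\<close>; it is applied with \<open>g = hook_norm q\<close>.\<close>

lemma prod_hooks:
  fixes g :: "nat \<Rightarrow> 'a :: comm_monoid_mult"
  assumes \<mu>: "is_partition \<mu>" "length \<mu> \<le> n"
  shows "(\<Prod>x\<in>boxes \<mu>. g (nat (hook \<mu> x))) *
         (\<Prod>i<n. \<Prod>k\<in>{i<..<n}. g (beta_seq n \<mu> i - beta_seq n \<mu> k)) =
         (\<Prod>i<n. \<Prod>k=1..beta_seq n \<mu> i. g k)"
proof -
  let ?p = "\<lambda>i. part \<mu> (Suc i)"
  have "(\<Prod>x\<in>boxes \<mu>. g (nat (hook \<mu> x))) =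
     (\<Prod>i<n. \<Prod>j=1..?p i. g (?p i - j + 1 + card {k\<in>{i<..<n}. j \<le> ?p k}))"
    unfolding prod_boxes[OF \<mu>(2)]
  proof (intro prod.cong refl arg_cong[where f = g])
    fix i j assume "i \<in> {..<n}" "j \<in> {1..?p i}"
    then have "hook \<mu> (Suc i, j) = int (?p i - j + 1 + card {k\<in>{i<..<n}. j \<le> ?p k})"
      by (intro hook_eq[OF \<mu>]) auto
    then show "nat (hook \<mu> (Suc i, j)) = ?p i - j + 1 + card {k\<in>{i<..<n}. j \<le> ?p k}"
      by (simp only: nat_int)
  qed
  moreover have "(\<Prod>i<n. \<Prod>k\<in>{i<..<n}. g (beta_seq n \<mu> i - beta_seq n \<mu> k)) =
     (\<Prod>i<n. \<Prod>k\<in>{i<..<n}. g (?p i + (k - i) - ?p k))"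
    by (intro prod.cong refl arg_cong[where f = g]) (auto simp: beta_seq_def staircase_def)
  moreover have "(\<Prod>i<n. \<Prod>k=1..beta_seq n \<mu> i. g k) = (\<Prod>i<n. \<Prod>k=1..?p i + (n - 1 - i). g k)"
    by (intro prod.cong refl) (auto simp: beta_seq_def staircase_def)
  moreover have "(\<Prod>j=1..?p i. g (?p i - j + 1 + card {k\<in>{i<..<n}. j \<le> ?p k})) *
         (\<Prod>k\<in>{i<..<n}. g (?p i + (k - i) - ?p k)) = (\<Prod>k=1..?p i + (n - 1 - i). g k)"
    if "i < n" for i
    using that part_antimono[OF \<mu>(1)] by (intro prod_row_hooks) auto
  ultimately show ?thesis
    by (simp add: prod.distrib[symmetric])
qed

text \<open>Each range is cut at \<open>staircase n i\<close>. The indices above the cut are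
  \<open>n\<close> plus the contents of the boxes in that row.\<close>

lemma prod_beta_seq_split:
  fixes f :: "nat \<Rightarrow> 'a :: comm_monoid_mult"
  assumes "length \<mu> \<le> n"
  shows "(\<Prod>i<n. \<Prod>k=1..beta_seq n \<mu> i. f k) =
         (\<Prod>i<n. \<Prod>k=1..staircase n i. f k) *
         (\<Prod>(i, j)\<in>boxes \<mu>. f (n + j - i))"
proof -
  have "(\<Prod>k=1..s + r. f k) = (\<Prod>k=1..s. f k) * (\<Prod>j=1..r. f (s + j))" for s r
    by (induction r) (auto simp: mult_ac)
  then have "(\<Prod>k=1..beta_seq n \<mu> i. f k) = (\<Prod>k=1..staircase n i. f k) *
       (\<Prod>j=1..part \<mu> (Suc i). f (n + j - Suc i))" if "i < n" for i
    using that by (simp add: beta_seq_def add.commute) (auto simp: staircase_def)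
  then show ?thesis
    by (simp add: prod_boxes[OF assms] prod.distrib)
qed

lemma sum_beta_seq:
  "length \<mu> \<le> n \<Longrightarrow> (\<Sum>i<n. beta_seq n \<mu> i) = sum_list \<mu> + (\<Sum>i<n. staircase n i)"
  by (simp add: beta_seq_def sum.distrib sum_part)

section \<open>Partitions in a rectangle as strictly decreasing sequences\<close>

lemma partition_eqI:
  assumes "is_partition \<mu>" "is_partition \<nu>" and eq: "\<And>i. part \<mu> (Suc i) = part \<nu> (Suc i)"
  shows "\<mu> = \<nu>"
proof -
  have len: "length \<mu> \<le> length \<nu>"
    if "is_partition \<mu>" and eq: "\<And>i. part \<mu> (Suc i) = part \<nu> (Suc i)" for \<mu> \<nu>
    using part_pos[OF that(1), of "length \<mu>"] eq[of "length \<mu> - 1"]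
    by (cases "length \<mu>") (auto simp: part_def split: if_splits)
  have "length \<mu> = length \<nu>"
    using len[of \<mu> \<nu>] len[of \<nu> \<mu>] assms by simp
  moreover have "\<mu> ! i = \<nu> ! i" if "i < length \<mu>" for i
    using eq[of i] that \<open>length \<mu> = length \<nu>\<close> by (simp add: part_def)
  ultimately show ?thesis
    by (rule nth_equalityI)
qed

lemma partition_of_antimono:
  fixes p :: "nat \<Rightarrow> nat"
  assumes "\<And>i j. i \<le> j \<Longrightarrow> j < n \<Longrightarrow> p j \<le> p i"
  shows "\<exists>\<mu>. is_partition \<mu> \<and> length \<mu> \<le> n \<and> (\<forall>i<n. part \<mu> (Suc i) = p i)"
proof -
  define xs where "xs = map p [0..<n]"
  \<comment> \<open>Cutting at the first zero removes exactly the zeros, since \<open>xs\<close> is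
    weakly decreasing.\<close>
  define \<mu> where "\<mu> = takeWhile (\<lambda>x. 0 < x) xs"
  have "sorted_wrt (\<ge>) xs"
    using assms by (auto simp: xs_def sorted_wrt_iff_nth_less)
  then have "is_partition \<mu>"
    unfolding is_partition_def
    by (metis \<mu>_def set_takeWhileD sorted_wrt_take takeWhile_eq_take)
  moreover have "length \<mu> \<le> n"
    using length_takeWhile_le[of "\<lambda>x. 0 < x" xs] by (simp add: \<mu>_def xs_def)
  moreover have "part \<mu> (Suc i) = p i" if i: "i < n" for i
  proof (cases "i < length \<mu>")
    case True
    then show ?thesis using i
      by (simp add: part_def \<mu>_def takeWhile_nth) (simp add: xs_def)
  next
    case False
    then have "length \<mu> < n" using i by simp
    then have "p (length \<mu>) = 0"
      using nth_length_takeWhile[of "\<lambda>x. 0 < x" xs] by (simp add: \<mu>_def[symmetric]) (simp add: xs_def)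
    then show ?thesis
      using assms[of "length \<mu>" i] False i by (simp add: part_def)
  qed
  ultimately show ?thesis by blast
qed

definition bounded_partitions :: "nat \<Rightarrow> nat \<Rightarrow> nat list set" where
  "bounded_partitions n m = {\<mu>. is_partition \<mu> \<and> length \<mu> \<le> n \<and> part \<mu> 1 \<le> m}"

text \<open>The inverse subtracts the staircase: it drops by one at each step, so strict decrease
  becomes weak decrease, and the bound \<open>m + n\<close> on the first entry becomes the bound
  \<open>m\<close> on the first part.\<close>

lemma bij_betw_beta_seq:
  "bij_betw (beta_seq n) (bounded_partitions n m) (strict_seqs n (m + n))"
proof (rule bij_betwI')
  fix \<mu> \<nu> assume "\<mu> \<in> bounded_partitions n m" "\<nu> \<in> bounded_partitions n m"
  then have *: "is_partition \<mu>" "is_partition \<nu>" "length \<mu> \<le> n" "length \<nu> \<le> n"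
    by (auto simp: bounded_partitions_def)
  show "(beta_seq n \<mu> = beta_seq n \<nu>) = (\<mu> = \<nu>)"
  proof
    assume eq: "beta_seq n \<mu> = beta_seq n \<nu>"
    have "part \<mu> (Suc i) = part \<nu> (Suc i)" for i
      using fun_cong[OF eq, of i] *(3,4) by (cases "i < n") (auto simp: beta_seq_def part_def)
    then show "\<mu> = \<nu>" by (rule partition_eqI[OF *(1,2)])
  qed simp
next
  fix \<mu> assume "\<mu> \<in> bounded_partitions n m"
  then have \<mu>: "is_partition \<mu>" "length \<mu> \<le> n" "part \<mu> 1 \<le> m"
    by (auto simp: bounded_partitions_def)
  show "beta_seq n \<mu> \<in> strict_seqs n (m + n)"
  proof -
    have "beta_seq n \<mu> j < beta_seq n \<mu> i" if "i < j" "j < n" for i j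
      using part_antimono[OF \<mu>(1), of "Suc i" "Suc j"] that by (simp add: beta_seq_def staircase_def)
    moreover have "beta_seq n \<mu> i < m + n" if "i < n" for i
      using part_antimono[OF \<mu>(1), of 1 "Suc i"] \<mu>(3) that by (simp add: beta_seq_def staircase_def)
    ultimately show ?thesis
      by (auto simp: strict_seqs_def) (simp add: beta_seq_def)
  qed
next
  fix l assume l: "l \<in> strict_seqs n (m + n)"
  have "l j - staircase n j \<le> l i - staircase n i" if "i \<le> j" "j < n" for i j
    using that
  proof (induction j rule: dec_induct)
    case (step j)
    then have "l (Suc j) < l j" using l by (auto simp: strict_seqs_def)
    then have "l (Suc j) - staircase n (Suc j) \<le> l j - staircase n j"
      using step.prems by (simp add: staircase_def)
    then show ?case using step by simp
  qed simp
  then have "\<exists>\<mu>. is_partition \<mu> \<and> length \<mu> \<le> n \<and> (\<forall>i<n. part \<mu> (Suc i) = l i - staircase n i)"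
    by (rule partition_of_antimono)
  then obtain \<mu> where \<mu>: "is_partition \<mu>" "length \<mu> \<le> n"
      "\<And>i. i < n \<Longrightarrow> part \<mu> (Suc i) = l i - staircase n i"
    by auto
  have "part \<mu> 1 \<le> m"
  proof (cases "n = 0")
    case False
    then have "l 0 < m + n" using l by (auto simp: strict_seqs_def)
    then show ?thesis using \<mu>(3)[of 0] False by (simp add: staircase_def)
  qed (use \<mu>(2) in \<open>simp add: part_def\<close>)
  moreover have "l = beta_seq n \<mu>"
    using \<mu>(3) strict_seqs_ge[OF l] l
    by (auto simp: beta_seq_def fun_eq_iff strict_seqs_def)
  ultimately show "\<exists>\<mu>\<in>bounded_partitions n m. l = beta_seq n \<mu>"
    using \<mu> by (auto simp: bounded_partitions_def)
qed

lemma finite_bounded_partitions: "finite (bounded_partitions n m)"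
  using bij_betw_finite[OF bij_betw_beta_seq] finite_strict_seqs by blast

section \<open>The sum at powers of q\<close>

text \<open>This is \<open>(q^(k/2) - q^(-k/2))^2\<close> written without square roots.\<close>

definition hook_norm :: "complex \<Rightarrow> nat \<Rightarrow> complex" where
  "hook_norm q k = (1 - q ^ k)\<^sup>2 / q ^ k"

text \<open>Giving one factor \<open>- a\<close> to each box turns the product of the two numerators
  into a polynomial in \<open>a = exp (- t)\<close>.\<close>

definition term_coeff :: "complex \<Rightarrow> complex \<Rightarrow> nat list \<Rightarrow> complex" where
  "term_coeff q a \<mu> = (\<Prod>x\<in>boxes \<mu>.
     - ((1 - a * q powi content x) * (1 - a * q powi (- content x)) / hook_norm q (nat (hook \<mu> x))))"

lemma prod_pairs_swap:
  "(\<Prod>i<n. \<Prod>k\<in>{i<..<n}. h i k) = (\<Prod>k<n. \<Prod>i<k. h i (k :: nat) :: 'a :: comm_monoid_mult)"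
proof (induction n)
  case (Suc n)
  have "(\<Prod>i<n. \<Prod>k\<in>{i<..<Suc n}. h i k) = (\<Prod>i<n. h i n * (\<Prod>k\<in>{i<..<n}. h i k))"
  proof (rule prod.cong)
    fix i assume "i \<in> {..<n}"
    then have "{i<..<Suc n} = insert n {i<..<n}" by auto
    then show "(\<Prod>k\<in>{i<..<Suc n}. h i k) = h i n * (\<Prod>k\<in>{i<..<n}. h i k)" by simp
  qed simp
  moreover have "{n<..<Suc n} = {}" by auto
  ultimately show ?case
    using Suc by (simp add: prod.distrib mult_ac)
qed simp

lemma prod_pairs_mult:
  "(\<Prod>k<n. \<Prod>i<k. X i * X (k :: nat)) = (\<Prod>i<n. X i ^ (n - 1) :: 'a :: comm_monoid_mult)"
proof (induction n)
  case (Suc n)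
  have "(\<Prod>i<n. X i ^ (n - 1)) * (\<Prod>i<n. X i) = (\<Prod>i<n. X i ^ n)"
    unfolding prod.distrib[symmetric] by (cases n) (simp_all add: mult.commute)
  moreover have "(\<Prod>i<n. X i * X n) = (\<Prod>i<n. X i) * X n ^ n"
    by (simp add: prod.distrib)
  ultimately show ?case
    unfolding prod.lessThan_Suc Suc diff_Suc_1 by (metis mult.assoc)
qed simp

text \<open>The square of \<open>x - y\<close> for two powers of \<open>q\<close> is a hook norm
  times \<open>x * y\<close>, and each index occurs in \<open>n - 1\<close> pairs.\<close>

lemma vdm_square_eq:
  assumes q: "q \<noteq> 0" and l: "l \<in> strict_seqs n M"
  shows "(vdm n (\<lambda>i. q ^ l i))\<^sup>2 =
    (\<Prod>i<n. \<Prod>k\<in>{i<..<n}. hook_norm q (l i - l k)) * (\<Prod>i<n. (q ^ l i) ^ (n - 1))"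
proof -
  have "(q ^ l k - q ^ l i)\<^sup>2 = hook_norm q (l i - l k) * (q ^ l i * q ^ l k)"
    if "i < k" "k < n" for i k
  proof -
    have "l k \<le> l i" using l that by (auto simp: strict_seqs_def intro: less_imp_le)
    then have "q ^ l i = q ^ (l i - l k) * q ^ l k" by (simp flip: power_add)
    then show ?thesis
      using q by (simp add: hook_norm_def field_simps power2_eq_square)
  qed
  then have "(vdm n (\<lambda>i. q ^ l i))\<^sup>2 =
     (\<Prod>k<n. \<Prod>i<k. hook_norm q (l i - l k) * (q ^ l i * q ^ l k))"
    by (simp add: vdm_def prod_power_distrib)
  then show ?thesis
    unfolding prod_pairs_swap prod_pairs_mult[symmetric] by (simp only: prod.distrib)
qed

text \<open>For \<open>b = q ^ n\<close> and \<open>k = n + c\<close> this is the signed numerator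
  in \<open>term_coeff\<close> of a box of content \<open>c\<close>, with
  \<open>a = q ^ n\<close>.\<close>

definition row_numer :: "nat \<Rightarrow> complex \<Rightarrow> complex \<Rightarrow> nat \<Rightarrow> complex" where
  "row_numer n q b k = (1 - q ^ k) * (b - q ^ k / q ^ n) / (q ^ k / q ^ n)"

lemma one_minus_power_neq_0:
  "\<forall>k\<ge>1. q ^ k \<noteq> 1 \<Longrightarrow> 1 \<le> k \<Longrightarrow> 1 - q ^ k \<noteq> (0 :: complex)"
  by (metis eq_iff_diff_eq_0)

text \<open>The power \<open>(q ^ l) ^ (n - 1)\<close> is the one that occurs in
  \<open>vdm_square_eq\<close>, where it completes the hook norms to a squared Vandermonde
  product.\<close>

lemma row_weight_eq_quotient:
  assumes q: "q \<noteq> 0" "\<forall>k\<ge>1. q ^ k \<noteq> 1" and n: "1 \<le> n"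
  shows "(\<Prod>k=1..l. row_numer n q b k) =
           row_weight n q b l * (q ^ l) ^ (n - 1) * (\<Prod>k=1..l. hook_norm q k)"
proof (induction l)
  case (Suc l)
  have "1 - q ^ Suc l \<noteq> 0" by (rule one_minus_power_neq_0[OF q(2)]) simp
  moreover have "q ^ n = q ^ (n - 1) * q" using n by (cases n) (simp_all add: mult.commute)
  ultimately have "row_numer n q b (Suc l) =
      q * (b - q ^ Suc l / q ^ n) / (1 - q ^ Suc l) * q ^ (n - 1) * hook_norm q (Suc l)"
    using q(1) unfolding row_numer_def hook_norm_def
    by (simp add: divide_simps power2_eq_square)
  moreover have "row_weight n q b (Suc l) =
      row_weight n q b l * (q * (b - q ^ Suc l / q ^ n) / (1 - q ^ Suc l))"
    unfolding row_weight_def by (simp only: prod.lessThan_Suc)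
  moreover have "(q ^ Suc l) ^ (n - 1) = (q ^ l) ^ (n - 1) * q ^ (n - 1)"
    by (simp only: power_Suc power_mult_distrib mult.commute)
  ultimately show ?case
    using Suc by (simp only: prod.nat_ivl_Suc' le_add1 plus_1_eq_Suc One_nat_def mult_ac)
qed (simp add: row_weight_def)

lemma hook_norm_neq_0:
  "q \<noteq> 0 \<Longrightarrow> \<forall>k\<ge>1. q ^ k \<noteq> 1 \<Longrightarrow> 1 \<le> k \<Longrightarrow> hook_norm q k \<noteq> 0"
  using one_minus_power_neq_0[of q k] by (simp add: hook_norm_def)

text \<open>The staircase factors complete the numerators to full rows by
  \<open>prod_beta_seq_split\<close>. The hook norms of differences of beta numbers complete the
  denominators by \<open>prod_hooks\<close>, and with the powers of \<open>q\<close> they form the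
  squared Vandermonde product.\<close>

lemma term_coeff_eq_shape_weight:
  assumes q: "q \<noteq> 0" "\<forall>k\<ge>1. q ^ k \<noteq> 1" and n: "1 \<le> n"
    and \<mu>: "\<mu> \<in> bounded_partitions n m"
  shows "term_coeff q (q ^ n) \<mu> * (\<Prod>i<n. \<Prod>k=1..staircase n i. row_numer n q (q ^ n) k) =
         vdm n (\<lambda>i. q ^ beta_seq n \<mu> i) * shape_weight n q (q ^ n) (beta_seq n \<mu>)"
proof -
  let ?l = "beta_seq n \<mu>"
  have part: "is_partition \<mu>" "length \<mu> \<le> n" using \<mu> by (auto simp: bounded_partitions_def)
  have l: "?l \<in> strict_seqs n (m + n)"
    using bij_betwE[OF bij_betw_beta_seq] \<mu> by blast
  define numer where "numer = (\<Prod>(i, j)\<in>boxes \<mu>. row_numer n q (q ^ n) (n + j - i))"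
  define H where "H = (\<Prod>x\<in>boxes \<mu>. hook_norm q (nat (hook \<mu> x)))"
  define S where "S = (\<Prod>i<n. \<Prod>k=1..staircase n i. row_numer n q (q ^ n) k)"
  define G where "G = (\<Prod>i<n. \<Prod>k=1..?l i. hook_norm q k)"
  define E where "E = (\<Prod>i<n. (q ^ ?l i) ^ (n - 1))"
  define Vp where "Vp = (\<Prod>i<n. \<Prod>k\<in>{i<..<n}. hook_norm q (?l i - ?l k))"
  define W where "W = (\<Prod>i<n. row_weight n q (q ^ n) (?l i))"
  define V where "V = vdm n (\<lambda>i. q ^ ?l i)"
  have "term_coeff q (q ^ n) \<mu> = numer / H"
    unfolding term_coeff_def numer_def H_def prod_dividef[symmetric]
  proof (rule prod.cong, safe)
    fix i j assume "(i, j) \<in> boxes \<mu>"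
    then have "i \<le> n" "1 \<le> i" using part by (auto simp: boxes_def)
    define c where "c = q powi content (i, j)"
    have c: "c \<noteq> 0" using q by (simp add: c_def)
    have "int (n + j - i) = int n + content (i, j)"
      using \<open>i \<le> n\<close> by (simp add: content_def)
    then have 1: "q ^ (n + j - i) = q ^ n * c"
      using q unfolding c_def by (metis power_int_add power_int_of_nat)
    show "- ((1 - q ^ n * q powi content (i, j)) * (1 - q ^ n * q powi - content (i, j)) /
            hook_norm q (nat (hook \<mu> (i, j)))) =
          row_numer n q (q ^ n) (n + j - i) / hook_norm q (nat (hook \<mu> (i, j)))"
      unfolding row_numer_def 1 power_int_minus c_def[symmetric]
      using q c by (simp add: divide_simps) (simp add: algebra_simps)?
  qed
  moreover have "S * numer = W * E * G"
  proof -
    have "S * numer = (\<Prod>i<n. \<Prod>k=1..?l i. row_numer n q (q ^ n) k)"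
      unfolding S_def numer_def by (rule prod_beta_seq_split[OF part(2), symmetric])
    also have "\<dots> = W * E * G"
      unfolding row_weight_eq_quotient[OF q n] W_def E_def G_def prod.distrib ..
    finally show ?thesis .
  qed
  moreover have "H * Vp = G"
    unfolding H_def Vp_def G_def by (rule prod_hooks[OF part])
  moreover have "G \<noteq> 0"
    using hook_norm_neq_0[OF q] by (simp add: G_def)
  moreover have "V * V = Vp * E"
    using vdm_square_eq[OF q(1) l] by (simp add: V_def Vp_def E_def power2_eq_square)
  ultimately have "term_coeff q (q ^ n) \<mu> * S = V * V * W"
  proof -
    assume *: "term_coeff q (q ^ n) \<mu> = numer / H" "S * numer = W * E * G" "H * Vp = G"
      "G \<noteq> 0" "V * V = Vp * E"
    have "term_coeff q (q ^ n) \<mu> * S = W * E * (H * Vp) / H"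
      using *(1,2,3) by (simp add: mult.commute)
    also have "\<dots> = V * V * W"
      using *(3,4,5) by auto
    finally show ?thesis .
  qed
  then show ?thesis
    by (simp add: S_def V_def W_def shape_weight_def mult_ac)
qed

lemma is_partition_Nil: "is_partition []"
  by (simp add: is_partition_def)

lemma sum_list_partition_eq_0: "is_partition \<mu> \<Longrightarrow> sum_list \<mu> = 0 \<longleftrightarrow> \<mu> = []"
  by (cases \<mu>) (auto simp: is_partition_def)

lemma term_coeff_Nil [simp]: "term_coeff q a [] = 1"
  by (simp add: term_coeff_def prod_boxes[of "[]" 0])

lemma fps_nth_prod_0:
  fixes f :: "'b \<Rightarrow> 'a :: comm_ring_1 fps"
  shows "fps_nth (prod f A) 0 = (\<Prod>x\<in>A. fps_nth (f x) 0)"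
  by (induction A rule: infinite_finite_induct) auto

text \<open>The closed form at \<open>m = n\<close>, with the staircase power of Q cancelled and the
  constant fixed by the empty partition. The width is \<open>n + 1\<close> because the closed form
  requires \<open>n + n < M\<close>, and width \<open>m\<close> corresponds to
  \<open>M = m + n\<close>.\<close>

lemma bounded_term_sum:
  assumes q: "q \<noteq> 0" "\<forall>k\<ge>1. q ^ k \<noteq> 1" and n: "1 \<le> n"
  shows "(\<Sum>\<mu>\<in>bounded_partitions n (n + 1). fps_const (term_coeff q (q ^ n) \<mu>) * fps_X ^ sum_list \<mu>)
         = (\<Prod>i<n. \<Prod>j<n. 1 - fps_X * fps_const (q ^ (i + j + 1)))"
proof -
  let ?B = "bounded_partitions n (n + 1)"
  define S where "S = (\<Prod>i<n. \<Prod>k=1..staircase n i. row_numer n q (q ^ n) k)"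
  define R where "R = (\<Sum>\<mu>\<in>?B. fps_const (term_coeff q (q ^ n) \<mu>) * fps_X ^ sum_list \<mu>)"
  define P :: "complex fps" where "P = (\<Prod>i<n. \<Prod>j<n. 1 - fps_X * fps_const (q ^ (i + j + 1)))"
  let ?s = "\<Sum>i<n. staircase n i"
  have "row_numer n q (q ^ n) k \<noteq> 0" if "1 \<le> k" "k < n" for k
  proof -
    have "q ^ n - q ^ k / q ^ n \<noteq> 0"
    proof
      assume "q ^ n - q ^ k / q ^ n = 0"
      then have "q ^ (n + n) = q ^ k" using q(1) by (simp add: field_simps power_add)
      moreover have "q ^ (n + n) = q ^ k * q ^ (n + n - k)"
        using that by (simp flip: power_add)
      ultimately show False using q that by simp
    qed
    then show ?thesis
      using one_minus_power_neq_0[OF q(2) that(1)] q(1) by (simp add: row_numer_def)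
  qed
  then have S: "S \<noteq> 0" by (auto simp: S_def staircase_def)
  have "shape_sum n (n + 1 + n) q (q ^ n) =
    (\<Sum>\<mu>\<in>?B. fps_const (vdm n (\<lambda>i. q ^ beta_seq n \<mu> i) * shape_weight n q (q ^ n) (beta_seq n \<mu>))
            * fps_X ^ (\<Sum>i<n. beta_seq n \<mu> i))"
    unfolding shape_sum_def by (rule sum.reindex_bij_betw[OF bij_betw_beta_seq, symmetric])
  also have "\<dots> = fps_const S * fps_X ^ ?s * R"
    unfolding R_def sum_distrib_left
  proof (rule sum.cong)
    fix \<mu> assume \<mu>: "\<mu> \<in> ?B"
    then have "(\<Sum>i<n. beta_seq n \<mu> i) = sum_list \<mu> + ?s"
      by (intro sum_beta_seq) (simp add: bounded_partitions_def)
    then show "fps_const (vdm n (\<lambda>i. q ^ beta_seq n \<mu> i) * shape_weight n q (q ^ n) (beta_seq n \<mu>))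
            * fps_X ^ (\<Sum>i<n. beta_seq n \<mu> i) =
          fps_const S * fps_X ^ ?s * (fps_const (term_coeff q (q ^ n) \<mu>) * fps_X ^ sum_list \<mu>)"
      unfolding term_coeff_eq_shape_weight[OF q n \<mu>, symmetric] S_def[symmetric]
      by (simp only: power_add mult_ac fps_const_mult[symmetric])
  qed simp
  finally have 1: "shape_sum n (n + 1 + n) q (q ^ n) = fps_const S * fps_X ^ ?s * R" .
  obtain c where c: "shape_sum n (n + 1 + n) q (q ^ n) = fps_const c * fps_X ^ ?s * P"
    using shape_sum_closed_form[OF q, of n n "n + 1 + n"] unfolding P_def by auto
  have eq: "fps_const S * R = fps_const c * P"
  proof -
    have "fps_X ^ ?s * (fps_const S * R) = fps_X ^ ?s * (fps_const c * P)"
      using 1 c by (simp add: mult_ac)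
    then show ?thesis by simp
  qed
  have "fps_nth R 0 = (\<Sum>\<mu>\<in>?B. if \<mu> = [] then 1 else 0)"
    unfolding R_def fps_sum_nth
    by (intro sum.cong)
       (auto simp: bounded_partitions_def sum_list_partition_eq_0 simp del: sum_list_eq_0_iff)
  also have "\<dots> = 1"
    using finite_bounded_partitions by (simp add: bounded_partitions_def is_partition_Nil part_def)
  finally have R0: "fps_nth R 0 = 1" .
  have P0: "fps_nth P 0 = 1"
    by (simp add: P_def fps_nth_prod_0)
  have "S = c"
    using arg_cong[OF eq, of "\<lambda>f. fps_nth f 0"] R0 P0 by simp
  with eq S have "R = P"
    by (simp add: fps_eq_iff)
  then show ?thesis by (simp add: R_def P_def)
qed

text \<open>Such a partition contains the box \<open>(1, n + 1)\<close> or
  \<open>(n + 1, 1)\<close>, of content \<open>n\<close> or \<open>- n\<close>, and there one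
  numerator is \<open>1 - q ^ n * q powi (- int n) = 0\<close>.\<close>

lemma term_coeff_eq_0:
  assumes q: "q \<noteq> 0" and \<mu>: "is_partition \<mu>" "\<mu> \<notin> bounded_partitions n (n + 1)"
  shows "term_coeff q (q ^ n) \<mu> = 0"
proof -
  have "\<exists>x\<in>boxes \<mu>. content x = int n \<or> content x = - int n"
  proof (cases "length \<mu> \<le> n")
    case True
    then have "n + 1 < part \<mu> 1" using \<mu> by (simp add: bounded_partitions_def)
    then have "(1, n + 1) \<in> boxes \<mu>" by (auto simp: boxes_def part_def split: if_splits)
    then show ?thesis by (intro bexI[of _ "(1, n + 1)"]) (simp_all add: content_def)
  next
    case False
    then have "(n + 1, 1) \<in> boxes \<mu>"
      using part_pos[OF \<mu>(1), of "n + 1"] by (simp add: boxes_def)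
    then show ?thesis by (intro bexI[of _ "(n + 1, 1)"]) (simp_all add: content_def)
  qed
  then obtain x where "x \<in> boxes \<mu>" "content x = int n \<or> content x = - int n" by blast
  then show ?thesis
    unfolding term_coeff_def using q
    by (intro prod_zero bexI[of _ x]) (auto simp: power_int_minus)
qed

lemma finite_partitions: "finite {\<mu>. is_partition \<mu> \<and> sum_list \<mu> = k}"
proof (rule finite_subset)
  have "length \<mu> \<le> sum_list \<mu>" if "is_partition \<mu>" for \<mu>
    using that unfolding is_partition_def by (induction \<mu>) (auto simp: Suc_le_eq intro: add_less_le_mono)
  then show "{\<mu>. is_partition \<mu> \<and> sum_list \<mu> = k} \<subseteq> {\<mu>. set \<mu> \<subseteq> {..k} \<and> length \<mu> \<le> k}"
    by (auto dest: member_le_sum_list)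
qed (rule finite_lists_length_le, simp)

definition partition_series :: "complex \<Rightarrow> complex \<Rightarrow> complex fps" where
  "partition_series q a = Abs_fps (\<lambda>k. \<Sum>\<mu> | is_partition \<mu> \<and> sum_list \<mu> = k. term_coeff q a \<mu>)"

lemma partition_series_power:
  assumes q: "q \<noteq> 0" "\<forall>k\<ge>1. q ^ k \<noteq> 1" and n: "1 \<le> n"
  shows "partition_series q (q ^ n) = (\<Prod>i<n. \<Prod>j<n. 1 - fps_X * fps_const (q ^ (i + j + 1)))"
proof (rule fps_ext)
  fix k
  let ?B = "bounded_partitions n (n + 1)"
  have "fps_nth (partition_series q (q ^ n)) k =
      (\<Sum>\<mu> | is_partition \<mu> \<and> sum_list \<mu> = k. term_coeff q (q ^ n) \<mu>)"
    by (simp add: partition_series_def)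
  also have "\<dots> = (\<Sum>\<mu> | \<mu> \<in> ?B \<and> sum_list \<mu> = k. term_coeff q (q ^ n) \<mu>)"
    using term_coeff_eq_0[OF q(1), of _ n] finite_partitions
    by (intro sum.mono_neutral_right) (auto simp: bounded_partitions_def)
  also have "\<dots> = (\<Sum>\<mu>\<in>?B. if sum_list \<mu> = k then term_coeff q (q ^ n) \<mu> else 0)"
    by (simp add: sum.inter_filter[OF finite_bounded_partitions])
  also have "\<dots> = fps_nth (\<Sum>\<mu>\<in>?B. fps_const (term_coeff q (q ^ n) \<mu>) * fps_X ^ sum_list \<mu>) k"
    by (auto simp: fps_sum_nth intro!: sum.cong)
  finally show "fps_nth (partition_series q (q ^ n)) k =
      fps_nth (\<Prod>i<n. \<Prod>j<n. 1 - fps_X * fps_const (q ^ (i + j + 1))) k"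
    by (simp only: bounded_term_sum[OF q n])
qed

section \<open>Exponentials of formal power series\<close>

text \<open>The differential equation determines each coefficient from the earlier ones, because
  \<open>of_nat (m + 1)\<close> is invertible in characteristic 0.\<close>

lemma fps_deriv_eq_mult_unique:
  fixes F G h :: "'a :: field_char_0 fps"
  assumes "fps_deriv F = F * h" "fps_deriv G = G * h" "fps_nth F 0 = fps_nth G 0"
  shows "F = G"
proof (rule fps_ext)
  fix n show "fps_nth F n = fps_nth G n"
  proof (induction n rule: less_induct)
    case (less n)
    show ?case
    proof (cases n)
      case (Suc m)
      have "of_nat (m + 1) * fps_nth F (m + 1) = of_nat (m + 1) * fps_nth G (m + 1)"
        unfolding fps_deriv_nth[symmetric] assms fps_mult_nth
        using less Suc by (intro sum.cong) auto
      then show ?thesis using Suc by (simp del: of_nat_Suc of_nat_add)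
    qed (use assms in simp)
  qed
qed

text \<open>Reduces an identity for an exponential to a linear differential equation and an initial
  value; the addition law and the logarithm below are proved this way.\<close>

lemma fps_exp_compose_eqI:
  fixes F g :: "'a :: field_char_0 fps"
  assumes "fps_nth g 0 = 0" "fps_nth F 0 = 1" "fps_deriv F = F * fps_deriv g"
  shows "F = fps_exp 1 oo g"
  using assms by (intro fps_deriv_eq_mult_unique[of F "fps_deriv g"]) (auto simp: fps_compose_deriv)

lemma fps_exp_compose_add:
  fixes f g :: "'a :: field_char_0 fps"
  assumes "fps_nth f 0 = 0" "fps_nth g 0 = 0"
  shows "(fps_exp 1 oo f) * (fps_exp 1 oo g) = fps_exp 1 oo (f + g)"
  using assms by (intro fps_exp_compose_eqI) (auto simp: fps_compose_deriv algebra_simps)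

lemma fps_exp_compose_uminus:
  fixes f :: "'a :: field_char_0 fps"
  assumes "fps_nth f 0 = 0"
  shows "inverse (fps_exp 1 oo f) = fps_exp 1 oo (- f)"
  using fps_exp_compose_add[of f "- f"] assms by (intro fps_inverse_unique) simp

lemma fps_exp_compose_prod:
  fixes f :: "'b \<Rightarrow> 'a :: field_char_0 fps"
  assumes "\<And>i. fps_nth (f i) 0 = 0"
  shows "(\<Prod>i\<in>A. fps_exp 1 oo f i) = fps_exp 1 oo (\<Sum>i\<in>A. f i)"
  by (induction A rule: infinite_finite_induct)
     (auto simp: fps_exp_compose_add assms fps_sum_nth)

lemma fps_exp_compose_power:
  fixes f :: "'a :: field_char_0 fps"
  assumes "fps_nth f 0 = 0"
  shows "(fps_exp 1 oo f) ^ n = fps_exp 1 oo (of_nat n * f)"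
  using fps_exp_compose_prod[of "\<lambda>_. f" "{..<n}"] assms by simp

text \<open>The series of \<open>log (1 - c Q)\<close>; at \<open>n = 0\<close> division by zero
  gives the coefficient 0.\<close>

definition log_series :: "'a :: field_char_0 \<Rightarrow> 'a fps" where
  "log_series c = Abs_fps (\<lambda>n. - (c ^ n / of_nat n))"

lemma log_series_nth [simp]: "fps_nth (log_series c) n = - (c ^ n / of_nat n)"
  by (simp add: log_series_def)

lemma one_minus_eq_exp_log_series: "1 - fps_X * fps_const c = fps_exp 1 oo log_series c"
proof (rule fps_exp_compose_eqI)
  have d: "fps_nth (fps_deriv (log_series c)) n = - (c ^ Suc n)" for n
    by (simp del: of_nat_Suc)
  show "fps_deriv (1 - fps_X * fps_const c) = (1 - fps_X * fps_const c) * fps_deriv (log_series c)"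
  proof (rule fps_ext)
    fix n show "fps_nth (fps_deriv (1 - fps_X * fps_const c)) n =
      fps_nth ((1 - fps_X * fps_const c) * fps_deriv (log_series c)) n"
      unfolding left_diff_distrib mult_1 fps_sub_nth d mult.assoc
      by (cases n) (simp_all add: d del: fps_deriv_nth)
  qed
qed simp_all

definition exponent_series :: "complex \<Rightarrow> complex \<Rightarrow> complex fps" where
  "exponent_series q a =
     Abs_fps (\<lambda>k. - ((1 - a ^ k)\<^sup>2 * (q ^ k / (1 - q ^ k)\<^sup>2) / of_nat k))"

lemma exponent_series_nth [simp]:
  "fps_nth (exponent_series q a) k = - ((1 - a ^ k)\<^sup>2 * (q ^ k / (1 - q ^ k)\<^sup>2) / of_nat k)"
  by (simp add: exponent_series_def)

text \<open>The quotient \<open>(1 - (q ^ n) ^ k) / (1 - q ^ k)\<close> is a finite geometric sum,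
  and its square is the double sum over \<open>i\<close> and \<open>j\<close>.\<close>

lemma exponent_series_power:
  assumes q: "\<forall>k\<ge>1. q ^ k \<noteq> 1"
  shows "exponent_series q (q ^ n) = (\<Sum>i<n. \<Sum>j<n. log_series (q ^ (i + j + 1)))"
proof (rule fps_ext)
  fix k
  show "fps_nth (exponent_series q (q ^ n)) k =
          fps_nth (\<Sum>i<n. \<Sum>j<n. log_series (q ^ (i + j + 1))) k"
  proof (cases "k = 0")
    case False
    then have k: "q ^ k \<noteq> 1" using q by simp
    have geo: "(\<Sum>i<n. (q ^ k) ^ i) = (1 - (q ^ n) ^ k) / (1 - q ^ k)"
      using k by (subst geometric_sum) (auto simp: divide_simps mult.commute simp flip: power_mult, simp add: algebra_simps)
    have "(\<Sum>i<n. \<Sum>j<n. (q ^ (i + j + 1)) ^ k) = q ^ k * ((\<Sum>i<n. (q ^ k) ^ i) * (\<Sum>j<n. (q ^ k) ^ j))"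
      by (simp add: sum_product sum_distrib_left power_add power_mult_distrib mult_ac flip: power_mult)
    also have "\<dots> = (1 - (q ^ n) ^ k)\<^sup>2 * (q ^ k / (1 - q ^ k)\<^sup>2)"
      unfolding geo by (simp add: power2_eq_square)
    finally show ?thesis
      by (simp add: fps_sum_nth sum_negf flip: sum_divide_distrib)
  qed (simp add: fps_sum_nth)
qed

section \<open>Polynomial dependence on a parameter\<close>

definition polynomial_map :: "(complex \<Rightarrow> complex) \<Rightarrow> bool" where
  "polynomial_map f \<longleftrightarrow> (\<exists>p. \<forall>x. f x = poly p x)"

lemma polynomial_map_const: "polynomial_map (\<lambda>_. c)"
  unfolding polynomial_map_def by (rule exI[of _ "[:c:]"]) simp

lemma polynomial_map_ident: "polynomial_map (\<lambda>x. x)"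
  unfolding polynomial_map_def by (rule exI[of _ "[:0, 1:]"]) simp

lemma polynomial_map_add:
  "polynomial_map f \<Longrightarrow> polynomial_map g \<Longrightarrow> polynomial_map (\<lambda>x. f x + g x)"
  unfolding polynomial_map_def by (metis poly_add)

lemma polynomial_map_mult:
  "polynomial_map f \<Longrightarrow> polynomial_map g \<Longrightarrow> polynomial_map (\<lambda>x. f x * g x)"
  unfolding polynomial_map_def by (metis poly_mult)

lemma polynomial_map_diff:
  "polynomial_map f \<Longrightarrow> polynomial_map g \<Longrightarrow> polynomial_map (\<lambda>x. f x - g x)"
  unfolding polynomial_map_def by (metis poly_diff)

lemma polynomial_map_power: "polynomial_map f \<Longrightarrow> polynomial_map (\<lambda>x. f x ^ n)"
  unfolding polynomial_map_def by (metis poly_power)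

lemma polynomial_map_sum:
  "(\<And>i. i \<in> A \<Longrightarrow> polynomial_map (f i)) \<Longrightarrow> polynomial_map (\<lambda>x. \<Sum>i\<in>A. f i x)"
  by (induction A rule: infinite_finite_induct)
     (auto intro: polynomial_map_const polynomial_map_add)

lemma polynomial_map_prod:
  "(\<And>i. i \<in> A \<Longrightarrow> polynomial_map (f i)) \<Longrightarrow> polynomial_map (\<lambda>x. \<Prod>i\<in>A. f i x)"
  by (induction A rule: infinite_finite_induct)
     (auto intro: polynomial_map_const polynomial_map_mult)

lemmas polynomial_map_intros =
  polynomial_map_const polynomial_map_ident polynomial_map_add polynomial_map_mult
  polynomial_map_diff polynomial_map_power polynomial_map_sum polynomial_map_prod

lemma polynomial_map_eqI:
  assumes "polynomial_map f" "polynomial_map g" and "infinite S" "\<And>x. x \<in> S \<Longrightarrow> f x = g x"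
  shows "f x = g x"
proof -
  obtain p r where p: "\<And>x. f x = poly p x" and r: "\<And>x. g x = poly r x"
    using assms by (auto simp: polynomial_map_def)
  have "p - r = 0"
  proof (rule ccontr)
    assume "p - r \<noteq> 0"
    then have "finite {x. poly (p - r) x = 0}" by (rule poly_roots_finite)
    moreover have "S \<subseteq> {x. poly (p - r) x = 0}" using assms(4) p r by auto
    ultimately show False using assms(3) finite_subset by blast
  qed
  then show ?thesis by (simp add: p r)
qed

lemma polynomial_map_fps_power:
  assumes "\<And>k. polynomial_map (\<lambda>x. fps_nth (F x) k)"
  shows "polynomial_map (\<lambda>x. fps_nth (F x ^ i) k)"
proof (induction i arbitrary: k)
  case (Suc i)
  then show ?case
    by (auto simp: fps_mult_nth intro!: polynomial_map_intros assms)
qed (auto intro: polynomial_map_const)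

text \<open>Each coefficient of a composition is a finite polynomial expression in the coefficients
  of the inner series.\<close>

lemma polynomial_map_fps_compose:
  assumes "\<And>k. polynomial_map (\<lambda>x. fps_nth (F x) k)"
  shows "polynomial_map (\<lambda>x. fps_nth (G oo F x) k)"
  unfolding fps_compose_nth by (intro polynomial_map_intros polynomial_map_fps_power assms)

section \<open>Coefficientwise limits and the infinite product\<close>

lemma tendsto_fps_nth_power:
  fixes G :: "nat \<Rightarrow> complex fps"
  assumes "\<And>k. (\<lambda>N. fps_nth (G N) k) \<longlonglongrightarrow> fps_nth L k"
  shows "(\<lambda>N. fps_nth (G N ^ i) k) \<longlonglongrightarrow> fps_nth (L ^ i) k"
proof (induction i arbitrary: k)
  case (Suc i)
  then show ?case
    by (auto simp: fps_mult_nth intro!: tendsto_intros assms)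
qed simp

lemma tendsto_fps_nth_compose:
  fixes G :: "nat \<Rightarrow> complex fps"
  assumes "\<And>k. (\<lambda>N. fps_nth (G N) k) \<longlonglongrightarrow> fps_nth L k"
  shows "(\<lambda>N. fps_nth (F oo G N) k) \<longlonglongrightarrow> fps_nth (F oo L) k"
  unfolding fps_compose_nth by (intro tendsto_intros tendsto_fps_nth_power assms)

definition factor_log :: "complex \<Rightarrow> complex \<Rightarrow> nat \<Rightarrow> complex fps" where
  "factor_log q a n = of_nat n * (log_series (q ^ n) + log_series (a\<^sup>2 * q ^ n))
     - of_nat (2 * n) * log_series (a * q ^ n)"

lemma conifold_factor_eq_exp: "conifold_factor q t n = fps_exp 1 oo factor_log q (exp (- t)) n"
proof -
  have a2: "exp (- 2 * t) = (exp (- t))\<^sup>2"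
    by (simp add: power2_eq_square flip: exp_add)
  have "fps_nth (fps_exp 1 oo log_series (exp (- t) * q ^ n)) 0 \<noteq> 0"
    by (simp del: fps_exp_compose_linear)
  then have "fps_nth ((fps_exp 1 oo log_series (exp (- t) * q ^ n)) ^ (2 * n)) 0 \<noteq> 0"
    by (simp add: fps_power_zeroth)
  then show ?thesis
    unfolding conifold_factor_def a2 one_minus_eq_exp_log_series factor_log_def
    by (simp add: fps_divide_unit fps_exp_compose_power fps_exp_compose_uminus
        fps_exp_compose_add algebra_simps del: of_nat_mult of_nat_numeral)
qed

text \<open>The three logarithms combine through
  \<open>1 + a ^ (2 * k) - 2 * a ^ k = (1 - a ^ k)^2\<close>.\<close>

lemma factor_log_nth:
  "fps_nth (factor_log q a n) k = - ((1 - a ^ k)\<^sup>2 / of_nat k) * (of_nat n * (q ^ k) ^ n)"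
proof -
  have "fps_nth (of_nat m * f) k = of_nat m * fps_nth f k" for m and f :: "complex fps"
    by (simp add: fps_of_nat[symmetric] del: fps_of_nat)
  then show ?thesis
    unfolding factor_log_def fps_sub_nth fps_add_nth
    by (simp add: power_mult_distrib power2_eq_square algebra_simps add_divide_distrib diff_divide_distrib
        flip: power_mult)
qed

text \<open>For \<open>z = q ^ k\<close> with \<open>k > 0\<close>, the sum of
  \<open>n * z ^ n\<close> is \<open>z / (1 - z)^2\<close>, the derivative of the geometric series;
  convergence uses \<open>norm q < 1\<close>.\<close>

lemma factor_log_sum_tendsto:
  assumes "norm q < 1"
  shows "(\<lambda>N. fps_nth (\<Sum>n=1..N. factor_log q a n) k) \<longlonglongrightarrow> fps_nth (exponent_series q a) k"
proof (cases "k = 0")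
  case False
  define z where "z = q ^ k"
  have "norm z < 1"
    using False assms by (simp add: z_def norm_power power_less_one_iff)
  then have "(\<lambda>n. of_nat (Suc n) * z ^ n) sums (1 / (1 - z)\<^sup>2)"
    by (rule geometric_deriv_sums)
  then have "(\<lambda>n. z * (of_nat (Suc n) * z ^ n)) sums (z * (1 / (1 - z)\<^sup>2))"
    by (rule sums_mult)
  then have "(\<lambda>N. \<Sum>n<N. z * (of_nat (Suc n) * z ^ n)) \<longlonglongrightarrow> z / (1 - z)\<^sup>2"
    by (simp add: sums_def)
  moreover have "(\<Sum>n<N. z * (of_nat (Suc n) * z ^ n)) = (\<Sum>n=1..N. of_nat n * z ^ n)" for N
    by (induction N) (simp_all add: algebra_simps)
  ultimately have "(\<lambda>N. - ((1 - a ^ k)\<^sup>2 / of_nat k) * (\<Sum>n=1..N. of_nat n * z ^ n))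
      \<longlonglongrightarrow> - ((1 - a ^ k)\<^sup>2 / of_nat k) * (z / (1 - z)\<^sup>2)"
    by (intro tendsto_mult_left) simp
  then show ?thesis
    by (simp add: fps_sum_nth factor_log_nth sum_distrib_left z_def mult.commute)
qed (simp add: fps_sum_nth factor_log_nth)

lemma has_coeffwise_prod_conifold_factor:
  assumes "norm q < 1"
  shows "has_coeffwise_prod (conifold_factor q t) (fps_exp 1 oo exponent_series q (exp (- t)))"
proof -
  have *: "fps_nth (factor_log q (exp (- t)) n) 0 = 0" for n
    by (simp add: factor_log_nth)
  show ?thesis
    unfolding has_coeffwise_prod_def conifold_factor_eq_exp fps_exp_compose_prod[OF * ]
    by (intro allI tendsto_fps_nth_compose factor_log_sum_tendsto[OF assms])
qed

section \<open>The quantum dimensions\<close>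

text \<open>The rows reaching column \<open>i\<close> form an initial segment because the parts
  decrease, so their number decides whether row \<open>j\<close> is among them.\<close>

lemma le_part_transposed_iff:
  assumes "is_partition \<mu>" "1 \<le> i" "1 \<le> j"
  shows "j \<le> part (transposed \<mu>) i \<longleftrightarrow> i \<le> part \<mu> j"
proof -
  define K where "K = {k. k < length \<mu> \<and> i \<le> part \<mu> (Suc k)}"
  have K: "part (transposed \<mu>) i = card K"
    using assms by (simp add: K_def part_transposed)
  show ?thesis
  proof (cases "i \<le> part \<mu> j")
    case True
    then have "j \<le> length \<mu>" using assms by (auto simp: part_def split: if_splits)
    moreover have "i \<le> part \<mu> (Suc k)" if "k < j" for k
      using part_antimono[OF assms(1), of "Suc k" j] that True by simp
    ultimately have "{..<j} \<subseteq> K" by (auto simp: K_def)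
    then have "card {..<j} \<le> card K" by (intro card_mono) (auto simp: K_def)
    then show ?thesis using True K by simp
  next
    case False
    have "k < j - 1" if "k \<in> K" for k
    proof (rule ccontr)
      assume "\<not> k < j - 1"
      then have "part \<mu> (Suc k) \<le> part \<mu> j"
        using part_antimono[OF assms(1), of j "Suc k"] assms(3) by simp
      then show False using that False by (simp add: K_def)
    qed
    then have "K \<subseteq> {..<j - 1}" by auto
    then have "card K \<le> card {..<j - 1}" by (intro card_mono) auto
    then show ?thesis using False K assms(3) by simp
  qed
qed

lemma length_transposed: "length (transposed \<mu>) = part \<mu> 1"
  by (simp add: transposed_def del: upt_Suc)

lemma is_partition_transposed:
  assumes "is_partition \<mu>"
  shows "is_partition (transposed \<mu>)"
proof -
  have nth: "transposed \<mu> ! i = part (transposed \<mu>) (Suc i)" if "i < length (transposed \<mu>)" for i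
    using that by (simp add: part_def)
  have "part (transposed \<mu>) (Suc j) \<le> part (transposed \<mu>) (Suc i)" if "i < j" for i j
    unfolding part_transposed[OF assms order.refl, of "Suc _", simplified]
    using that by (intro card_mono) auto
  then have "sorted_wrt (\<ge>) (transposed \<mu>)"
    by (auto simp: sorted_wrt_iff_nth_less nth)
  moreover have "0 < transposed \<mu> ! i" if "i < length (transposed \<mu>)" for i
    using le_part_transposed_iff[OF assms, of "Suc i" 1] that by (simp add: nth length_transposed)
  ultimately show ?thesis
    by (auto simp: is_partition_def in_set_conv_nth)
qed

text \<open>Two uses of \<open>le_part_transposed_iff\<close> show that the same positive numbers
  lie below both sides.\<close>

lemma part_transposed_transposed:
  assumes "is_partition \<mu>" "1 \<le> i"
  shows "part (transposed (transposed \<mu>)) i = part \<mu> i"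
proof -
  have *: "j \<le> part (transposed (transposed \<mu>)) i \<longleftrightarrow> j \<le> part \<mu> i" if "1 \<le> j" for j
    using le_part_transposed_iff[OF is_partition_transposed[OF assms(1)] assms(2) that]
      le_part_transposed_iff[OF assms(1) that assms(2)] by simp
  show ?thesis
    using *[of "part \<mu> i"] *[of "part (transposed (transposed \<mu>)) i"]
    by (cases "part \<mu> i"; cases "part (transposed (transposed \<mu>)) i") auto
qed

lemma in_boxes_iff:
  "(i, j) \<in> boxes \<mu> \<longleftrightarrow> 1 \<le> i \<and> 1 \<le> j \<and> j \<le> part \<mu> i"
  by (auto simp: boxes_def part_def split: if_splits)

lemma boxes_transposed:
  assumes "is_partition \<mu>"
  shows "boxes (transposed \<mu>) = prod.swap ` boxes \<mu>"
proof -
  have "(i, j) \<in> boxes (transposed \<mu>) \<longleftrightarrow> (j, i) \<in> boxes \<mu>" for i j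
    using le_part_transposed_iff[OF assms, of i j] by (auto simp: in_boxes_iff)
  then show ?thesis by force
qed

lemma hook_transposed:
  assumes "is_partition \<mu>" "x \<in> boxes \<mu>"
  shows "hook (transposed \<mu>) (prod.swap x) = hook \<mu> x"
  using assms part_transposed_transposed[OF assms(1), of "fst x"]
  by (cases x) (auto simp: hook_def in_boxes_iff)

lemma content_swap: "content (prod.swap x) = - content x"
  by (cases x) (simp add: content_def)

lemma quantum_dim_transposed:
  assumes "is_partition \<mu>"
  shows "quantum_dim s t (transposed \<mu>) =
     (\<Prod>x\<in>boxes \<mu>. (exp (t / 2) * s powi (- content x) - exp (- t / 2) * s powi content x) /
        (s powi hook \<mu> x - s powi (- hook \<mu> x)))"
  unfolding quantum_dim_def boxes_transposed[OF assms]
  by (subst prod.reindex) (auto simp: content_swap hook_transposed[OF assms] intro!: prod.cong)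

lemma square_power_diff:
  assumes "s\<^sup>2 = q" "q \<noteq> 0"
  shows "(s powi int k - s powi (- int k))\<^sup>2 = hook_norm q k"
proof -
  have "s \<noteq> 0" "q ^ k = (s ^ k)\<^sup>2"
    using assms by (auto simp: power2_eq_square power_mult_distrib)
  then show ?thesis
    by (simp add: hook_norm_def power_int_minus field_simps power2_eq_square)
qed

lemma hook_nonneg:
  assumes "is_partition \<mu>" "x \<in> boxes \<mu>"
  shows "0 \<le> hook \<mu> x"
proof -
  obtain i j where x: "x = (i, j)" by (cases x)
  then have "1 \<le> i" "i \<le> length \<mu>" "1 \<le> j" "j \<le> part \<mu> i"
    using assms(2) by (auto simp: boxes_def)
  then show ?thesis
    using hook_eq[OF assms(1) order.refl, of "i - 1" j] x by simp
qed

text \<open>There are |\<mu>| boxes, so each receives one factor \<open>exp (- t)\<close> and one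
  sign. Transposition negates the content and keeps the hook length, so the two numerators of a box
  pair up over a common squared denominator.\<close>

lemma conifold_term_eq:
  assumes s: "s\<^sup>2 = q" "q \<noteq> 0" and \<mu>: "is_partition \<mu>"
  shows "exp (- of_nat (sum_list \<mu>) * t) * quantum_dim s t (transposed \<mu>) * (- 1) ^ sum_list \<mu> *
           quantum_dim s t \<mu> = term_coeff q (exp (- t)) \<mu>"
proof -
  have box: "exp (- t) * ((exp (t / 2) * s powi (- c) - exp (- t / 2) * s powi c) / d) * (- 1) *
      ((exp (t / 2) * s powi c - exp (- t / 2) * s powi (- c)) / d) =
      - ((1 - exp (- t) * q powi c) * (1 - exp (- t) * q powi (- c)) / d\<^sup>2)" for c d
  proof -
    define S where "S = s powi c"
    define e where "e = exp (t / 2)"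
    have "s \<noteq> 0" using s by auto
    then have nz: "S \<noteq> 0" "e \<noteq> 0" by (auto simp: S_def e_def)
    have q: "q powi c = S\<^sup>2"
      unfolding S_def s(1)[symmetric] by (simp add: power2_eq_square power_int_mult_distrib)
    have e: "exp (- t) = 1 / e\<^sup>2" "exp (- t / 2) = 1 / e"
    proof -
      have "e\<^sup>2 = exp t" by (simp add: e_def power2_eq_square mult_exp_exp)
      then show "exp (- t) = 1 / e\<^sup>2" by (simp add: exp_minus divide_inverse)
      have "- t / 2 = - (t / 2)" by simp
      then show "exp (- t / 2) = 1 / e" unfolding e_def by (metis exp_minus inverse_eq_divide)
    qed
    have "1 / e\<^sup>2 * (e / S - S / e) * (- 1) * (e * S - 1 / e / S) =
        - ((1 - S\<^sup>2 / e\<^sup>2) * (1 - 1 / e\<^sup>2 / S\<^sup>2))"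
      using nz by (simp add: field_simps power2_eq_square)
    then have "1 / e\<^sup>2 * (e / S - S / e) * (- 1) * (e * S - 1 / e / S) / d\<^sup>2 =
        - ((1 - S\<^sup>2 / e\<^sup>2) * (1 - 1 / e\<^sup>2 / S\<^sup>2)) / d\<^sup>2"
      by simp
    then show ?thesis
      unfolding power_int_minus q S_def[symmetric] e e_def[symmetric]
      by (simp add: divide_inverse power2_eq_square mult_ac)
  qed
  have "exp (- of_nat (sum_list \<mu>) * t) = (\<Prod>x\<in>boxes \<mu>. exp (- t))"
    by (simp add: card_boxes flip: exp_of_nat_mult)
  moreover have "(- 1) ^ sum_list \<mu> = (\<Prod>x\<in>boxes \<mu>. - 1 :: complex)"
    by (simp add: card_boxes)
  ultimately have "exp (- of_nat (sum_list \<mu>) * t) * quantum_dim s t (transposed \<mu>) *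
      (- 1) ^ sum_list \<mu> * quantum_dim s t \<mu> =
    (\<Prod>x\<in>boxes \<mu>. - ((1 - exp (- t) * q powi content x) * (1 - exp (- t) * q powi (- content x)) /
        (s powi hook \<mu> x - s powi (- hook \<mu> x))\<^sup>2))"
    unfolding quantum_dim_transposed[OF \<mu>] box[symmetric] prod.distrib
    by (simp only: quantum_dim_def)
  also have "\<dots> = term_coeff q (exp (- t)) \<mu>"
    unfolding term_coeff_def
  proof (rule prod.cong)
    fix x assume "x \<in> boxes \<mu>"
    then have "hook \<mu> x = int (nat (hook \<mu> x))" using hook_nonneg[OF \<mu>] by simp
    then have "(s powi hook \<mu> x - s powi (- hook \<mu> x))\<^sup>2 = hook_norm q (nat (hook \<mu> x))"
      using square_power_diff[OF s] by metis
    then show "- ((1 - exp (- t) * q powi content x) * (1 - exp (- t) * q powi (- content x)) /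
        (s powi hook \<mu> x - s powi (- hook \<mu> x))\<^sup>2) =
      - ((1 - exp (- t) * q powi content x) * (1 - exp (- t) * q powi (- content x)) /
        hook_norm q (nat (hook \<mu> x)))"
      by simp
  qed simp
  finally show ?thesis .
qed

lemma conifold_Z_eq_partition_series:
  assumes s: "s\<^sup>2 = q" "q \<noteq> 0"
  shows "conifold_Z s t = partition_series q (exp (- t))"
proof -
  let ?f = "\<lambda>\<mu>. fps_const (term_coeff q (exp (- t)) \<mu>) * fps_X ^ sum_list \<mu>"
  have "conifold_Z s t = infsum ?f {\<mu>. is_partition \<mu>}"
    unfolding conifold_Z_def
  proof (rule infsum_cong)
    fix \<mu> assume "\<mu> \<in> {\<mu>. is_partition \<mu>}"
    then have \<mu>: "is_partition \<mu>" by simp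
    show "fps_const (exp (- of_nat (sum_list \<mu>) * t) * quantum_dim s t (transposed \<mu>)
          * (- 1) ^ sum_list \<mu>) * fps_X ^ sum_list \<mu> * fps_const (quantum_dim s t \<mu>) = ?f \<mu>"
      unfolding conifold_term_eq[OF s \<mu>, symmetric]
      by (simp only: fps_const_mult[symmetric] mult_ac)
  qed
  also have "\<dots> = partition_series q (exp (- t))"
  proof (rule infsumI)
    show "(?f has_sum partition_series q (exp (- t))) {\<mu>. is_partition \<mu>}"
      unfolding has_sum_def
    proof (rule tendsto_fpsI)
      fix k
      \<comment> \<open>Once a finite set contains all partitions of \<open>k\<close>, the
        coefficient of Q^k no longer changes; this is convergence in the Q-adic topology.\<close>
      let ?K = "{\<mu>. is_partition \<mu> \<and> sum_list \<mu> = k}"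
      have "fps_nth (sum ?f Y) k = fps_nth (partition_series q (exp (- t))) k"
        if Y: "finite Y" "?K \<subseteq> Y" "Y \<subseteq> {\<mu>. is_partition \<mu>}" for Y
      proof -
        have "fps_nth (sum ?f Y) k =
            (\<Sum>\<mu>\<in>Y. if sum_list \<mu> = k then term_coeff q (exp (- t)) \<mu> else 0)"
          by (auto simp: fps_sum_nth intro!: sum.cong)
        also have "\<dots> = (\<Sum>\<mu>\<in>?K. term_coeff q (exp (- t)) \<mu>)"
          using Y by (intro sum.mono_neutral_cong_right) auto
        finally show ?thesis by (simp add: partition_series_def)
      qed
      then show "\<forall>\<^sub>F Y in finite_subsets_at_top {\<mu>. is_partition \<mu>}.
          fps_nth (sum ?f Y) k = fps_nth (partition_series q (exp (- t))) k"
        unfolding eventually_finite_subsets_at_top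
        by (intro exI[of _ ?K]) (auto simp: finite_partitions)
    qed
  qed
  finally show ?thesis .
qed

lemma polynomial_map_partition_series:
  "polynomial_map (\<lambda>a. fps_nth (partition_series q a) k)"
proof -
  have "term_coeff q a \<mu> = (\<Prod>x\<in>boxes \<mu>. - 1 / hook_norm q (nat (hook \<mu> x)) *
      (1 - a * q powi content x) * (1 - a * q powi (- content x)))" for a \<mu>
    unfolding term_coeff_def by (intro prod.cong) auto
  then have "polynomial_map (\<lambda>a. term_coeff q a \<mu>)" for \<mu>
    by (simp only:) (intro polynomial_map_intros)
  then show ?thesis
    unfolding partition_series_def fps_nth_Abs_fps by (intro polynomial_map_sum)
qed

lemma polynomial_map_exponent_series:
  "polynomial_map (\<lambda>a. fps_nth (exponent_series q a) k)"
proof -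
  have "fps_nth (exponent_series q a) k =
      (1 - a ^ k) ^ 2 * (- (q ^ k / (1 - q ^ k)\<^sup>2) / of_nat k)" for a
    by simp
  then show ?thesis
    by (simp only:) (intro polynomial_map_intros)
qed

text \<open>Both coefficients are polynomial in \<open>a\<close> and agree at the positive powers of
  \<open>q\<close>. These are infinitely many points, since \<open>q\<close> is nonzero and not a
  root of unity.\<close>

lemma partition_series_eq_exp:
  assumes q: "q \<noteq> 0" "\<forall>k\<ge>1. q ^ k \<noteq> 1"
  shows "partition_series q a = fps_exp 1 oo exponent_series q a"
proof (rule fps_ext)
  fix k
  show "fps_nth (partition_series q a) k = fps_nth (fps_exp 1 oo exponent_series q a) k"
  proof (rule polynomial_map_eqI[where x = a and S = "range (\<lambda>n. q ^ Suc n)"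
        and f = "\<lambda>a. fps_nth (partition_series q a) k"
        and g = "\<lambda>a. fps_nth (fps_exp 1 oo exponent_series q a) k"])
    have "inj (\<lambda>n. q ^ Suc n)"
    proof (rule linorder_injI)
      fix m n :: nat assume "m < n"
      then have "q ^ Suc n = q ^ Suc m * q ^ (n - m)" by (simp flip: power_Suc power_add)
      moreover have "q ^ (n - m) \<noteq> 1" using q(2) \<open>m < n\<close> by simp
      ultimately show "q ^ Suc m \<noteq> q ^ Suc n" using q(1) by simp
    qed
    then show "infinite (range (\<lambda>n. q ^ Suc n))"
      by (rule range_inj_infinite)
  next
    fix x assume "x \<in> range (\<lambda>n. q ^ Suc n)"
    then obtain n where x: "x = q ^ n" "1 \<le> n"
      by (metis Suc_eq_plus1 le_add2 rangeE)
    have "partition_series q x = (\<Prod>i<n. \<Prod>j<n. 1 - fps_X * fps_const (q ^ (i + j + 1)))"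
      unfolding x(1) by (rule partition_series_power[OF q x(2)])
    also have "\<dots> = fps_exp 1 oo exponent_series q x"
      unfolding x(1) exponent_series_power[OF q(2)] one_minus_eq_exp_log_series
      by (simp add: fps_exp_compose_prod fps_sum_nth del: power_add)
    finally show "fps_nth (partition_series q x) k = fps_nth (fps_exp 1 oo exponent_series q x) k"
      by simp
  qed (intro polynomial_map_partition_series polynomial_map_fps_compose
      polynomial_map_exponent_series)+
qed

lemma conifold_exponent_eq:
  assumes "s\<^sup>2 = q" "q \<noteq> 0"
  shows "conifold_exponent s t = exponent_series q (exp (- t))"
proof (rule fps_ext)
  fix k
  have "exp (- of_nat k * t) = exp (- t) ^ k"
    by (simp flip: exp_of_nat_mult)
  then show "fps_nth (conifold_exponent s t) k = fps_nth (exponent_series q (exp (- t))) k"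
    unfolding conifold_exponent_def fps_neg_nth fps_nth_Abs_fps square_power_diff[OF assms]
    by (simp add: hook_norm_def mult.commute)
qed

theorem theorem6p2:
  fixes q s t :: complex
  assumes "s\<^sup>2 = q" and "q \<noteq> 0" and "\<forall>n\<ge>1. q ^ n \<noteq> 1"
  shows "conifold_Z s t = fps_compose (fps_exp 1) (conifold_exponent s t) \<and>
         (norm q < 1 \<longrightarrow> has_coeffwise_prod (conifold_factor q t) (conifold_Z s t))"
  using conifold_Z_eq_partition_series[OF assms(1,2)] partition_series_eq_exp[OF assms(2,3)]
    conifold_exponent_eq[OF assms(1,2)] has_coeffwise_prod_conifold_factor
  by simp

end
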